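(* Let $G=SU(2)$, let $(\mathcal H^n,U^n)$ be the irreducible unitary representation of $G$ of highest weight $n$, let $\mathcal B^n=\mathcal B(\mathcal H^n)$, let $\kappa$ be the irreducible representation of $\mathbb C\ell(\mathfrak g')$ on $\mathcal S=\mathbb C^2$ for which $\kappa_{\boldsymbol\gamma}=-I_2$, let $D$ be the Dirac operator on $\mathcal B^n\otimes\mathcal S$, defined on elementary tensors by $D(T\otimes\psi)=\sum_{j=1}^3[U^n_{E_j},T]\otimes\kappa_{\epsilon_j}(\psi)$, and set $D'=D+2$. Then the spectrum of $D'$ consists of the even numbers $\pm2k$ for $1\le k\le n$ together with $2(n+1)$. For each $k$ with $1\le k\le n$ the multiplicity of the eigenvalue $\pm2k$ is $2k=\dim(\mathcal H^{2k-1})$ (that is, each of $2k$ and $-2k$ has this multiplicity), while the multiplicity of $2(n+1)$ is $2(n+1)=\dim(\mathcal H^{2n+1})$. The spectrum of $D$ is just the spectrum of $D'$ shifted by $-2$.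
   Context: $\mathfrak g=su(2)$ has basis $E_1=\begin{pmatrix}0&i\\ i&0\end{pmatrix}$, $E_2=\begin{pmatrix}0&-1\\1&0\end{pmatrix}$, $E_3=\begin{pmatrix}i&0\\0&-i\end{pmatrix}$, orthonormal for the inner product $\langle X,Y\rangle=-\tfrac12\mathrm{trace}(XY)$; $\mathfrak g'$ is the dual vector space of $\mathfrak g$ with the dual inner product, and $\{\epsilon_j\}_{j=1}^3$ is the dual (orthonormal) basis of $\mathfrak g'$. $\mathbb C\ell(\mathfrak g')$ is the complex Clifford algebra generated by $\epsilon_1,\epsilon_2,\epsilon_3$ with relations $\epsilon_j\epsilon_k+\epsilon_k\epsilon_j=-2\delta_{jk}$ and involution $\epsilon_j^*=-\epsilon_j$. Its chirality element is $\boldsymbol\gamma=\epsilon_1\epsilon_2\epsilon_3$, which is central, self-adjoint, and has square $1$; $\mathbb C\ell(\mathfrak g')$ has exactly two inequivalent irreducible $*$-representations, both two-dimensional, distinguished by whether $\boldsymbol\gamma$ is sent to $I_2$ or to $-I_2$. For each $k$, $(\mathcal H^k,U^k)$ denotes the irreducible unitary representation of $SU(2)$ of highest weight $k$, so $\dim\mathcal H^k=k+1$; $U^k$ also denotes the corresponding infinitesimal representation of $\mathfrak g$. $\mathcal B(\mathcal H^n)$ is the algebra of all linear operators on $\mathcal H^n$.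
   Formalization: The formal theorem assumes κ_γ = +I_2 instead of κ_γ = −I_2; with −I_2 and the stated conventions the claim fails for every n ≥ 1 (for n = 1, D' has eigenvalue 0). *)

theory Defs
  imports "HOL-Analysis.Analysis"
begin

section \<open>Matrices over the complex numbers\<close>

definition hconj :: "complex^'n^'m \<Rightarrow> complex^'m^'n" where
  "hconj A = (\<chi> i j. cnj (A $ j $ i))"

text \<open>Scalar multiplication of matrices: the type of matrices is a nested vector type, on which
  \<open>*s\<close> would multiply by a row vector.\<close>

definition mscale :: "complex \<Rightarrow> complex^'n^'m \<Rightarrow> complex^'n^'m" where
  "mscale c A = (\<chi> i j. c * A $ i $ j)"

text \<open>The matrix type carries no Banach algebra structure for \<open>**\<close>, so the exponential series is
  written out; \<open>((**) A ^^ k) (mat 1)\<close> is the \<open>k\<close>-th matrix power of \<open>A\<close>.\<close>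

definition mat_exp :: "complex^'n^'n \<Rightarrow> complex^'n^'n" where
  "mat_exp A = (\<Sum>k. (1 / fact k) *\<^sub>R ((**) A ^^ k) (mat 1))"

text \<open>Spectrum of a linear operator, and geometric multiplicity as the dimension of the eigenspace.\<close>

definition op_spectrum :: "(complex^'m \<Rightarrow> complex^'m) \<Rightarrow> complex set" where
  "op_spectrum f = {z. \<not> bij (\<lambda>v. f v - z *s v)}"

definition eigen_mult :: "(complex^'m \<Rightarrow> complex^'m) \<Rightarrow> complex \<Rightarrow> nat" where
  "eigen_mult f z = vec.dim {v. f v = z *s v}"


section \<open>The group \<open>SU(2)\<close> and its irreducible unitary representations\<close>

definition SU2 :: "(complex^2^2) set" where
  "SU2 = {A. hconj A ** A = mat 1 \<and> det A = 1}"

text \<open>The basis \<open>E\<^sub>1, E\<^sub>2, E\<^sub>3\<close> of \<open>su(2)\<close>; only the indices 1, 2, 3 are meaningful.\<close>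

definition su2E :: "nat \<Rightarrow> complex^2^2" where
  "su2E j =
    (if j = 1 then vector [vector [0, \<i>], vector [\<i>, 0]]
     else if j = 2 then vector [vector [0, -1], vector [1, 0]]
     else vector [vector [\<i>, 0], vector [0, -\<i>]])"

definition unitary_rep :: "(complex^2^2 \<Rightarrow> complex^'d^'d) \<Rightarrow> bool" where
  "unitary_rep U \<longleftrightarrow>
     continuous_on SU2 U \<and>
     (\<forall>g\<in>SU2. \<forall>h\<in>SU2. U (g ** h) = U g ** U h) \<and>
     (\<forall>g\<in>SU2. hconj (U g) ** U g = mat 1)"

definition irreducible_rep :: "(complex^2^2 \<Rightarrow> complex^'d^'d) \<Rightarrow> bool" where
  "irreducible_rep U \<longleftrightarrow>
     (\<forall>W. vec.subspace W \<and> (\<forall>g\<in>SU2. \<forall>w\<in>W. U g *v w \<in> W) \<longrightarrow> W = {0} \<or> W = UNIV)"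

definition inf_rep :: "(complex^2^2 \<Rightarrow> complex^'d^'d) \<Rightarrow> complex^2^2 \<Rightarrow> complex^'d^'d" where
  "inf_rep U X = vector_derivative (\<lambda>t::real. U (mat_exp (t *\<^sub>R X))) (at 0)"

text \<open>Weights are taken with respect to the Cartan element \<open>H = diag(1, -1) = - \<i> E\<^sub>3\<close>.\<close>

definition is_weight :: "(complex^2^2 \<Rightarrow> complex^'d^'d) \<Rightarrow> real \<Rightarrow> bool" where
  "is_weight U \<mu> \<longleftrightarrow> (\<exists>v. v \<noteq> 0 \<and> inf_rep U (su2E 3) *v v = (\<i> * of_real \<mu>) *s v)"

definition highest_weight :: "(complex^2^2 \<Rightarrow> complex^'d^'d) \<Rightarrow> nat \<Rightarrow> bool" where
  "highest_weight U n \<longleftrightarrow> is_weight U (real n) \<and> (\<forall>\<mu>. is_weight U \<mu> \<longrightarrow> \<mu> \<le> real n)"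

definition SU2_irrep :: "(complex^2^2 \<Rightarrow> complex^'d^'d) \<Rightarrow> nat \<Rightarrow> bool" where
  "SU2_irrep U n \<longleftrightarrow> unitary_rep U \<and> irreducible_rep U \<and> highest_weight U n"

lemma su2E_skew: "hconj (su2E j) = - su2E j"
  by (simp add: su2E_def hconj_def vec_eq_iff forall_2)

lemma su2E_orthonormal:
  assumes "j \<in> {1..3}" "k \<in> {1..3}"
  shows "- (1/2) * trace (su2E j ** su2E k) = (if j = k then 1 else 0)"
proof -
  have "j = 1 \<or> j = 2 \<or> j = 3" "k = 1 \<or> k = 2 \<or> k = 3" using assms by auto
  then show ?thesis
    by (elim disjE) (simp_all add: su2E_def trace_def matrix_matrix_mult_def sum_2)
qed


section \<open>The Clifford algebra of the dual of \<open>su(2)\<close>\<close>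

text \<open>A vector is the list of its coordinates in the basis
  \<open>\<epsilon>\<^sub>1\<^sup>a \<epsilon>\<^sub>2\<^sup>b \<epsilon>\<^sub>3\<^sup>c\<close> with \<open>a, b, c \<in> {0, 1}\<close>.  The product of the basis elements \<open>p\<close> and \<open>q\<close> is
  \<open>cl_sign p q\<close> times the basis element \<open>cl_xor p q\<close>: one sign for every pair of distinct generators
  that has to be interchanged and one for every square \<open>\<epsilon>\<^sub>j\<^sup>2 = -1\<close>.\<close>

type_synonym clifford = "complex^(bool \<times> bool \<times> bool)"

fun cl_xor :: "bool \<times> bool \<times> bool \<Rightarrow> bool \<times> bool \<times> bool \<Rightarrow> bool \<times> bool \<times> bool" where
  "cl_xor (a, b, c) (a', b', c') = (a \<noteq> a', b \<noteq> b', c \<noteq> c')"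

fun cl_sign :: "bool \<times> bool \<times> bool \<Rightarrow> bool \<times> bool \<times> bool \<Rightarrow> complex" where
  "cl_sign (a, b, c) (a', b', c') =
     (-1) ^ (of_bool (b \<and> a') + of_bool (c \<and> a') + of_bool (c \<and> b')
           + of_bool (a \<and> a') + of_bool (b \<and> b') + of_bool (c \<and> c'))"

definition cl_mult :: "clifford \<Rightarrow> clifford \<Rightarrow> clifford" (infixl \<open>\<odot>\<close> 70) where
  "x \<odot> y = (\<chi> r. \<Sum>p\<in>UNIV. \<Sum>q\<in>UNIV. if cl_xor p q = r then cl_sign p q * x $ p * y $ q else 0)"

definition cl_one :: clifford where
  "cl_one = axis (False, False, False) 1"

definition cl_gen :: "nat \<Rightarrow> clifford" where
  "cl_gen j = axis (j = 1, j = 2, j = 3) 1"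

text \<open>Each basis element \<open>p\<close> is unitary, so its adjoint is its inverse \<open>cl_sign p p\<close> times \<open>p\<close>.\<close>

definition cl_star :: "clifford \<Rightarrow> clifford" where
  "cl_star x = (\<chi> p. cl_sign p p * cnj (x $ p))"

definition cl_gamma :: clifford where
  "cl_gamma = cl_gen 1 \<odot> cl_gen 2 \<odot> cl_gen 3"

lemma UNIV_bool3:
  "(UNIV :: (bool \<times> bool \<times> bool) set) =
    {(True, True, True), (True, True, False), (True, False, True), (True, False, False),
     (False, True, True), (False, True, False), (False, False, True), (False, False, False)}"
  by auto

lemma all_bool3:
  "(\<forall>p :: bool \<times> bool \<times> bool. P p) \<longleftrightarrow>
     P (True, True, True) \<and> P (True, True, False) \<and> P (True, False, True) \<and> P (True, False, False) \<and>
     P (False, True, True) \<and> P (False, True, False) \<and> P (False, False, True) \<and> P (False, False, False)"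
proof -
  have "(\<forall>p. P p) \<longleftrightarrow> (\<forall>p\<in>UNIV. P p)" by simp
  then show ?thesis unfolding UNIV_bool3 by simp
qed

lemma sum_bool3:
  fixes f :: "bool \<times> bool \<times> bool \<Rightarrow> complex"
  shows "sum f UNIV =
     f (True, True, True) + f (True, True, False) + f (True, False, True) + f (True, False, False) +
     f (False, True, True) + f (False, True, False) + f (False, False, True) + f (False, False, False)"
  unfolding UNIV_bool3 by simp

lemma sum_xor:
  fixes f :: "bool \<times> bool \<times> bool \<Rightarrow> complex"
  shows "(\<Sum>q\<in>UNIV. f (cl_xor p q)) = sum f UNIV"
proof -
  have "cl_xor p (cl_xor p q) = q" for q by (cases p; cases q; auto)
  then have "bij (cl_xor p)" by (rule involuntory_imp_bij)
  then show ?thesis by (rule sum.reindex_bij_betw)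
qed

lemma cl_xor_eq: "cl_xor p q = r \<longleftrightarrow> q = cl_xor p r"
  by (cases p; cases q; cases r; auto)

lemma cl_mult_nth: "(x \<odot> y) $ r = (\<Sum>p\<in>UNIV. cl_sign p (cl_xor p r) * x $ p * y $ cl_xor p r)"
  by (simp add: cl_mult_def cl_xor_eq)

lemma cl_sign_cocycle:
  "cl_sign s (cl_xor s r) * cl_sign p (cl_xor p s) = cl_sign p (cl_xor p r) * cl_sign (cl_xor p s) (cl_xor s r)"
proof -
  obtain a b c where p: "p = (a, b, c)" by (cases p)
  obtain a' b' c' where r: "r = (a', b', c')" by (cases r)
  obtain a'' b'' c'' where s: "s = (a'', b'', c'')" by (cases s)
  show ?thesis unfolding p r s
    by (cases a; cases b; cases c; cases a'; cases b'; cases c'; cases a''; cases b''; cases c''; simp)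
qed

lemma cl_mult_assoc: "(x \<odot> y) \<odot> z = x \<odot> (y \<odot> z)"
proof -
  have "((x \<odot> y) \<odot> z) $ r = (x \<odot> (y \<odot> z)) $ r" for r
  proof -
    have xor: "cl_xor (cl_xor p s) (cl_xor p r) = cl_xor s r" for p s
      by (cases p; cases s; cases r; auto)
    have "((x \<odot> y) \<odot> z) $ r = (\<Sum>s\<in>UNIV. \<Sum>p\<in>UNIV.
        (cl_sign s (cl_xor s r) * cl_sign p (cl_xor p s)) * (x $ p * y $ cl_xor p s * z $ cl_xor s r))"
      by (simp add: cl_mult_nth sum_distrib_left sum_distrib_right mult_ac)
    also have "\<dots> = (\<Sum>p\<in>UNIV. \<Sum>s\<in>UNIV. cl_sign p (cl_xor p r) * x $ p *
        (cl_sign (cl_xor p s) (cl_xor s r) * y $ cl_xor p s * z $ cl_xor s r))"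
      by (subst sum.swap) (simp only: cl_sign_cocycle mult_ac)
    also have "\<dots> = (\<Sum>p\<in>UNIV. \<Sum>q\<in>UNIV. cl_sign p (cl_xor p r) * x $ p *
        (cl_sign q (cl_xor q (cl_xor p r)) * y $ q * z $ cl_xor q (cl_xor p r)))"
    proof (rule sum.cong[OF refl])
      fix p
      show "(\<Sum>s\<in>UNIV. cl_sign p (cl_xor p r) * x $ p *
          (cl_sign (cl_xor p s) (cl_xor s r) * y $ cl_xor p s * z $ cl_xor s r)) =
        (\<Sum>q\<in>UNIV. cl_sign p (cl_xor p r) * x $ p *
          (cl_sign q (cl_xor q (cl_xor p r)) * y $ q * z $ cl_xor q (cl_xor p r)))"
        using sum_xor[of "\<lambda>q. cl_sign p (cl_xor p r) * x $ p *
          (cl_sign q (cl_xor q (cl_xor p r)) * y $ q * z $ cl_xor q (cl_xor p r))" p]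
        by (simp only: xor)
    qed
    also have "\<dots> = (x \<odot> (y \<odot> z)) $ r"
      by (simp add: cl_mult_nth sum_distrib_left)
    finally show ?thesis .
  qed
  then show ?thesis by (simp add: vec_eq_iff)
qed

lemmas cl_simps = vec_eq_iff all_bool3 cl_mult_nth sum_bool3 axis_def

lemma cl_one_left: "cl_one \<odot> x = x"
  and cl_one_right: "x \<odot> cl_one = x"
  by (simp_all add: cl_simps cl_one_def)

lemma cl_mult_add_left: "(x + y) \<odot> z = x \<odot> z + y \<odot> z"
  and cl_mult_add_right: "x \<odot> (y + z) = x \<odot> y + x \<odot> z"
  by (simp_all add: vec_eq_iff cl_mult_nth sum.distrib distrib_left distrib_right)

lemma cl_mult_scale_left: "(c *s x) \<odot> y = c *s (x \<odot> y)"
  and cl_mult_scale_right: "x \<odot> (c *s y) = c *s (x \<odot> y)"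
  by (simp_all add: vec_eq_iff cl_mult_nth sum_distrib_left mult_ac)

lemma cl_gen_anticommute:
  assumes "j \<in> {1..3}" "k \<in> {1..3}"
  shows "cl_gen j \<odot> cl_gen k + cl_gen k \<odot> cl_gen j = (if j = k then - 2 else 0) *s cl_one"
proof -
  have "j = 1 \<or> j = 2 \<or> j = 3" "k = 1 \<or> k = 2 \<or> k = 3" using assms by auto
  then show ?thesis
    by (elim disjE) (simp_all add: cl_simps cl_gen_def cl_one_def)
qed

lemma cl_star_gen: "j \<in> {1..3} \<Longrightarrow> cl_star (cl_gen j) = - cl_gen j"
  by (auto simp add: cl_simps cl_gen_def cl_star_def)

lemma cl_star_mult: "cl_star (x \<odot> y) = cl_star y \<odot> cl_star x"
  by (simp add: cl_simps cl_star_def algebra_simps)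

lemma cl_star_add: "cl_star (x + y) = cl_star x + cl_star y"
  and cl_star_scale: "cl_star (c *s x) = cnj c *s cl_star x"
  and cl_star_star: "cl_star (cl_star x) = x"
  by (simp_all add: cl_simps cl_star_def algebra_simps)

lemma cl_gamma_eq: "cl_gamma = axis (True, True, True) 1"
  by (simp add: cl_simps cl_gen_def cl_gamma_def)

lemma cl_gamma_central: "cl_gamma \<odot> x = x \<odot> cl_gamma"
  and cl_gamma_selfadjoint: "cl_star cl_gamma = cl_gamma"
  and cl_gamma_square: "cl_gamma \<odot> cl_gamma = cl_one"
  by (simp_all add: cl_simps cl_star_def cl_one_def cl_gamma_eq)

text \<open>The basis elements really are the ordered products of generators, so these generate.\<close>

lemma cl_basis:
  "axis (a, b, c) 1 = (if a then cl_gen 1 else cl_one) \<odot> (if b then cl_gen 2 else cl_one)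
                        \<odot> (if c then cl_gen 3 else cl_one)"
  by (cases a; cases b; cases c; simp add: cl_simps cl_gen_def cl_one_def)

definition clifford_rep :: "(clifford \<Rightarrow> complex^'s^'s) \<Rightarrow> bool" where
  "clifford_rep \<kappa> \<longleftrightarrow>
     (\<forall>x y. \<kappa> (x + y) = \<kappa> x + \<kappa> y) \<and>
     (\<forall>c x. \<kappa> (c *s x) = mscale c (\<kappa> x)) \<and>
     (\<forall>x y. \<kappa> (x \<odot> y) = \<kappa> x ** \<kappa> y) \<and>
     \<kappa> cl_one = mat 1 \<and>
     (\<forall>x. \<kappa> (cl_star x) = hconj (\<kappa> x))"

definition clifford_irrep :: "(clifford \<Rightarrow> complex^'s^'s) \<Rightarrow> bool" where
  "clifford_irrep \<kappa> \<longleftrightarrow> clifford_rep \<kappa> \<and>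
     (\<forall>W. vec.subspace W \<and> (\<forall>x. \<forall>w\<in>W. \<kappa> x *v w \<in> W) \<longrightarrow> W = {0} \<or> W = UNIV)"


section \<open>The Dirac operator\<close>

text \<open>The tensor product of the \<open>d \<times> d\<close> matrices with the spinor space has coordinates indexed by
  \<open>((i, j), a)\<close>, where \<open>(i, j)\<close> is a matrix position and \<open>a\<close> a spinor index.\<close>

definition tensor :: "complex^'d^'d \<Rightarrow> complex^'s \<Rightarrow> complex^(('d \<times> 'd) \<times> 's)" where
  "tensor T \<psi> = (\<chi> p. T $ fst (fst p) $ snd (fst p) * \<psi> $ snd p)"

definition commutator :: "complex^'d^'d \<Rightarrow> complex^'d^'d \<Rightarrow> complex^'d^'d" where
  "commutator A B = A ** B - B ** A"

definition slice :: "complex^(('d \<times> 'd) \<times> 's) \<Rightarrow> 's::finite \<Rightarrow> complex^'d^'d" where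
  "slice X a = (\<chi> i j. X $ ((i, j), a))"

text \<open>The linear extension of the formula on elementary tensors, see \<open>dirac_tensor\<close> and
  \<open>dirac_unique\<close> below; \<open>X\<close> is the sum over \<open>b\<close> of the tensors of \<open>slice X b\<close> with the \<open>b\<close>-th
  standard basis vector.

  Pitfall: the two irreducible representations of the Clifford algebra give operators that are
  negatives of each other up to unitary equivalence, so the sign of \<open>\<kappa> cl_gamma\<close> matters for the
  spectrum.  Since \<open>E\<^sub>1 E\<^sub>2 = E\<^sub>3\<close>, the representation with \<open>\<kappa> cl_gamma = - 1\<close> is equivalent to
  \<open>\<epsilon>\<^sub>j \<mapsto> E\<^sub>j\<close>, where the eigenvalues are \<open>2(k + 1)\<close> for \<open>1 \<le> k \<le> n\<close> and \<open>- 2(k - 1)\<close> for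
  \<open>1 \<le> k \<le> n + 1\<close>; the one with \<open>\<kappa> cl_gamma = 1\<close> is equivalent to \<open>\<epsilon>\<^sub>j \<mapsto> - E\<^sub>j\<close> and has the
  opposite eigenvalues.  A shift by \<open>+ 2\<close> therefore makes the spectrum symmetric up to its
  largest element for \<open>\<kappa> cl_gamma = 1\<close>, and a shift by \<open>- 2\<close> symmetric up to its smallest one
  for \<open>\<kappa> cl_gamma = - 1\<close>.\<close>

definition dirac ::
  "(complex^2^2 \<Rightarrow> complex^'d^'d) \<Rightarrow> (clifford \<Rightarrow> complex^'s^'s)
    \<Rightarrow> complex^(('d \<times> 'd) \<times> 's) \<Rightarrow> complex^(('d \<times> 'd) \<times> 's)" where
  "dirac U \<kappa> X = (\<Sum>b\<in>UNIV. \<Sum>j=1..3.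
     tensor (commutator (inf_rep U (su2E j)) (slice X b)) (\<kappa> (cl_gen j) *v axis b 1))"

lemma tensor_slices:
  fixes X :: "complex^(('d::finite \<times> 'd) \<times> 's::finite)"
  shows "X = (\<Sum>b\<in>UNIV. tensor (slice X b) (axis b 1))"
proof -
  have "c * (if i = b then 1 else 0) = (if b = i then c else 0)" for c :: complex and i b :: 's
    by simp
  then show ?thesis
    by (simp add: vec_eq_iff tensor_def slice_def axis_def)
qed

lemma commutator_add: "commutator A (B + C) = commutator A B + commutator A C"
  by (simp add: commutator_def matrix_add_ldistrib matrix_matrix_mult_def vec_eq_iff
      sum.distrib algebra_simps)

lemma commutator_mscale: "commutator A (mscale c B) = mscale c (commutator A B)"
  by (simp add: commutator_def mscale_def matrix_matrix_mult_def vec_eq_iff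
      sum_distrib_left algebra_simps)

lemma tensor_add_left: "tensor (S + T) \<psi> = tensor S \<psi> + tensor T \<psi>"
  and tensor_mscale: "tensor (mscale c T) \<psi> = c *s tensor T \<psi>"
  and tensor_vscale: "tensor T (c *s \<psi>) = c *s tensor T \<psi>"
  by (simp_all add: tensor_def mscale_def vec_eq_iff algebra_simps)

lemma tensor_sum_right: "tensor T (\<Sum>b\<in>B. f b) = (\<Sum>b\<in>B. tensor T (f b))"
  by (simp add: tensor_def vec_eq_iff sum_distrib_left)

lemma dirac_linear:
  fixes U :: "complex^2^2 \<Rightarrow> complex^'d^'d" and \<kappa> :: "clifford \<Rightarrow> complex^'s^'s"
  shows "Vector_Spaces.linear (*s) (*s) (dirac U \<kappa>)"
proof -
  have "slice (X + Y) b = slice X b + slice Y b" "slice (c *s X) b = mscale c (slice X b)"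
    for X Y :: "complex^(('d::finite \<times> 'd) \<times> 's::finite)" and b c
    by (simp_all add: slice_def mscale_def vec_eq_iff)
  then show ?thesis
    by unfold_locales
      (simp_all add: dirac_def commutator_add commutator_mscale tensor_add_left tensor_mscale
        sum.distrib vec.scale_sum_right vec.scale_right_distrib vec.scale_left_distrib)
qed

lemma dirac_tensor:
  fixes U :: "complex^2^2 \<Rightarrow> complex^'d^'d" and \<kappa> :: "clifford \<Rightarrow> complex^'s^'s"
  shows "dirac U \<kappa> (tensor T \<psi>) =
     (\<Sum>j=1..3. tensor (commutator (inf_rep U (su2E j)) T) (\<kappa> (cl_gen j) *v \<psi>))"
proof -
  have sl: "slice (tensor T \<psi>) b = mscale (\<psi> $ b) T" for b
    by (simp add: slice_def tensor_def mscale_def vec_eq_iff)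
  have ax: "(A *v axis b 1) $ i = A $ i $ b" for A :: "complex^'s^'s" and b i
  proof -
    have "c * (if j = b then 1 else 0) = (if b = j then c else 0)" for c :: complex and j by simp
    then show ?thesis by (simp add: matrix_vector_mult_def axis_def)
  qed
  have "tensor S (A *v \<psi>) = (\<Sum>b\<in>UNIV. tensor (mscale (\<psi> $ b) S) (A *v axis b 1))"
    for S :: "complex^'d^'d" and A :: "complex^'s^'s"
    by (simp add: tensor_def mscale_def vec_eq_iff matrix_vector_mult_def[of A \<psi>]
        ax sum_distrib_left mult_ac)
  then show ?thesis
    unfolding dirac_def sl commutator_mscale by (subst sum.swap) simp
qed

lemma dirac_unique:
  assumes "Vector_Spaces.linear (*s) (*s) D"
    and "\<And>T \<psi>. D (tensor T \<psi>) =
      (\<Sum>j=1..3. tensor (commutator (inf_rep U (su2E j)) T) (\<kappa> (cl_gen j) *v \<psi>))"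
  shows "D = dirac U \<kappa>"
proof
  fix X
  interpret D: Vector_Spaces.linear "(*s)" "(*s)" D by fact
  interpret E: Vector_Spaces.linear "(*s)" "(*s)" "dirac U \<kappa>" by (rule dirac_linear)
  show "D X = dirac U \<kappa> X"
    by (subst (1 2) tensor_slices[of X]) (simp add: D.sum E.sum assms(2) dirac_tensor)
qed

end

theory Submission
  imports Defs
begin

text \<open>The infinitesimal representation gives matrices \<open>A 1, A 2, A 3\<close> with
  \<open>[A 1, A 2] = 2 A 3\<close> and its cyclic variants, hence an \<open>sl(2)\<close>-triple
  \<open>h = -\<i> A 3\<close>, \<open>e = (\<i> A 1 + A 2)/2\<close>, \<open>f = (\<i> A 1 - A 2)/2\<close>.  When \<open>\<kappa> \<gamma> = 1\<close> there are
  spinors \<open>up, down\<close> in which the Dirac operator takes the ladder form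
  \<open>D (T \<otimes> up) = 2 [e,T] \<otimes> down + [h,T] \<otimes> up\<close> and
  \<open>D (T \<otimes> down) = 2 [f,T] \<otimes> up - [h,T] \<otimes> down\<close> (\<open>dirac_up\<close>, \<open>dirac_down\<close>).

  For every \<open>l \<le> n\<close> the matrix power \<open>e\<^sup>l\<close> is nonzero and is a highest weight vector of weight
  \<open>2l\<close> for the commutator action.  Put \<open>T\<^sub>k = (ad f)\<^sup>k (e\<^sup>l)\<close>.  The operator \<open>D\<close> maps the span of
  \<open>T\<^sub>k \<otimes> up\<close> and \<open>T\<^sub>k\<^sub>-\<^sub>1 \<otimes> down\<close> into itself, with eigenvalues \<open>2l\<close> and \<open>-2l - 2\<close>.  So
  \<open>D' = D + 2\<close> has the eigenvalue \<open>2l + 2\<close> on the \<open>2l + 2\<close> vectors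
  \<open>T\<^sub>k \<otimes> up + k T\<^sub>k\<^sub>-\<^sub>1 \<otimes> down\<close> with \<open>0 \<le> k \<le> 2l + 1\<close>, and the eigenvalue \<open>-2l\<close> on the \<open>2l\<close> vectors
  \<open>T\<^sub>k \<otimes> up - (2l + 1 - k) T\<^sub>k\<^sub>-\<^sub>1 \<otimes> down\<close> with \<open>1 \<le> k \<le> 2l\<close>.  Within one eigenvalue of \<open>D'\<close> these
  vectors are told apart by their weights, that is by the eigenvalues of the operator
  \<open>weight_op\<close>.  All these eigenvalues being real, \<open>D' + \<i> weight_op\<close> has
  pairwise distinct eigenvalues on the whole family, which is therefore independent.

  It remains to count: over all \<open>l\<close> the family has \<open>2(n + 1)\<^sup>2\<close> members, and this is
  the dimension of the space because \<open>dim \<H>\<^sup>n = n + 1\<close> (\<open>su2_irrep.dimension\<close>).  The family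
  is an eigenbasis, and the spectrum with its multiplicities can be read off (\<open>eigenbasis\<close>).
  This count replaces the decomposition of \<open>\<B>\<^sup>n \<otimes> \<S>\<close> into
  irreducible representations: exhibiting enough eigenvectors is sufficient.

  The commutation relations require some Lie theory, as \<open>U\<close> is only assumed to be continuous.
  A continuous one-parameter group of matrices is differentiable
  (\<open>one_parameter_group_differentiable\<close>).  Every element of \<open>SU(2)\<close> is conjugate into a single
  one-parameter group, so \<open>U\<close> satisfies a Lipschitz estimate at \<open>1\<close> (\<open>U_near_one\<close>), and
  consequently the derivative of \<open>U\<close> along a curve through \<open>1\<close> depends only, and linearly, on
  the velocity of the curve (\<open>U_curve\<close>).  Differentiating the conjugation of one one-parameter
  group by another then gives the commutators (\<open>dU_commutator\<close>).\<close>

section \<open>Matrix calculus\<close>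

lemma bounded_bilinear_matrix_mult:
  "bounded_bilinear ((**) :: complex^'n^'m \<Rightarrow> complex^'p^'n \<Rightarrow> complex^'p^'m)"
  unfolding bilinear_conv_bounded_bilinear[symmetric] bilinear_def
  by (intro conjI allI linearI)
    (simp_all add: matrix_matrix_mult_def vec_eq_iff algebra_simps sum.distrib scaleR_sum_right)

interpretation mm: bounded_bilinear "(**) :: complex^'n^'m \<Rightarrow> complex^'p^'n \<Rightarrow> complex^'p^'m"
  by (rule bounded_bilinear_matrix_mult)

lemma bounded_bilinear_matrix_vector_mult:
  "bounded_bilinear ((*v) :: complex^'n^'m \<Rightarrow> complex^'n \<Rightarrow> complex^'m)"
  unfolding bilinear_conv_bounded_bilinear[symmetric] bilinear_def
  by (intro conjI allI linearI)
    (simp_all add: matrix_vector_mult_def vec_eq_iff algebra_simps sum.distrib scaleR_sum_right)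

interpretation mv: bounded_bilinear "(*v) :: complex^'n^'m \<Rightarrow> complex^'n \<Rightarrow> complex^'m"
  by (rule bounded_bilinear_matrix_vector_mult)

lemma mscale_of_real: "mscale (complex_of_real r) A = r *\<^sub>R A"
  by (simp add: mscale_def vec_eq_iff scaleR_conv_of_real[where 'a=complex])

lemma mscale_nth: "mscale c X $ i $ j = c * X $ i $ j"
  by (simp add: mscale_def)

section \<open>Unit quaternions\<close>

text \<open>The quaternion \<open>a + b i + c j + d k\<close> under the identification of \<open>i, j, k\<close> with
  \<open>E\<^sub>1, E\<^sub>2, E\<^sub>3\<close>, which multiply like the quaternion units.\<close>

definition quat :: "real \<Rightarrow> real \<Rightarrow> real \<Rightarrow> real \<Rightarrow> complex^2^2" where
  "quat a b c d = vector [vector [Complex a d, Complex (- c) b], vector [Complex c b, Complex a (- d)]]"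

lemmas mat2_simps = vec_eq_iff forall_2 matrix_matrix_mult_def sum_2 complex_eq_iff

lemma quat_eq_iff: "quat a b c d = quat a' b' c' d' \<longleftrightarrow> a = a' \<and> b = b' \<and> c = c' \<and> d = d'"
  by (auto simp: quat_def mat2_simps)

lemma quat_mult:
  "quat a b c d ** quat a' b' c' d' =
     quat (a * a' - b * b' - c * c' - d * d') (a * b' + b * a' + c * d' - d * c')
          (a * c' - b * d' + c * a' + d * b') (a * d' + b * c' - c * b' + d * a')"
  by (simp add: quat_def mat2_simps algebra_simps)

lemma quat_add: "quat a b c d + quat a' b' c' d' = quat (a + a') (b + b') (c + c') (d + d')"
  and quat_scaleR: "r *\<^sub>R quat a b c d = quat (r * a) (r * b) (r * c) (r * d)"
  and quat_minus: "- quat a b c d = quat (- a) (- b) (- c) (- d)"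
  by (simp_all add: quat_def mat2_simps)

lemma quat_one: "mat 1 = quat 1 0 0 0" and quat_zero: "0 = quat 0 0 0 0"
  by (simp_all add: quat_def mat2_simps mat_def)

lemma hconj_quat: "hconj (quat a b c d) = quat a (- b) (- c) (- d)"
  by (simp add: quat_def mat2_simps hconj_def)

lemma su2E_quat: "su2E 1 = quat 0 1 0 0" "su2E (Suc 0) = quat 0 1 0 0"
  "su2E 2 = quat 0 0 1 0" "su2E 3 = quat 0 0 0 1"
  by (simp_all add: quat_def mat2_simps su2E_def)

lemma det_quat: "det (quat a b c d) = of_real (a\<^sup>2 + b\<^sup>2 + c\<^sup>2 + d\<^sup>2)"
  by (simp add: quat_def det_2 complex_eq_iff power2_eq_square)

lemma quat_in_SU2: "quat a b c d \<in> SU2 \<longleftrightarrow> a\<^sup>2 + b\<^sup>2 + c\<^sup>2 + d\<^sup>2 = 1"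
  by (auto simp: SU2_def det_quat hconj_quat quat_mult quat_one quat_eq_iff power2_eq_square
      simp flip: of_real_add of_real_mult of_real_power)

text \<open>A unitary matrix of determinant \<open>1\<close> has its adjugate as adjoint, which ties the second
  row to the first one.\<close>

lemma SU2_eq_quat: "g \<in> SU2 \<longleftrightarrow> (\<exists>a b c d. g = quat a b c d \<and> a\<^sup>2 + b\<^sup>2 + c\<^sup>2 + d\<^sup>2 = 1)"
proof
  assume g: "g \<in> SU2"
  define adj :: "complex^2^2" where "adj = vector [vector [g$2$2, - g$1$2], vector [- g$2$1, g$1$1]]"
  have "g ** adj = mat 1"
    using g by (simp add: SU2_def det_2 adj_def vec_eq_iff forall_2 matrix_matrix_mult_def sum_2 mat_def
        algebra_simps)
  then have "hconj g = hconj g ** (g ** adj)" by simp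
  also have "\<dots> = adj" using g by (simp add: SU2_def matrix_mul_assoc)
  finally have "hconj g = adj" .
  then have "cnj (g$1$1) = g$2$2" "cnj (g$1$2) = - g$2$1"
    by (simp_all add: hconj_def adj_def vec_eq_iff forall_2)
  then have "g = quat (Re (g$1$1)) (Im (g$1$2)) (- Re (g$1$2)) (Im (g$1$1))"
    by (auto simp: quat_def mat2_simps)
  then show "\<exists>a b c d. g = quat a b c d \<and> a\<^sup>2 + b\<^sup>2 + c\<^sup>2 + d\<^sup>2 = 1"
    using g quat_in_SU2 by metis
qed (auto simp: quat_in_SU2)

lemma SU2_mult: "g \<in> SU2 \<Longrightarrow> h \<in> SU2 \<Longrightarrow> g ** h \<in> SU2"
proof -
  assume "g \<in> SU2" "h \<in> SU2"
  then obtain a b c d a' b' c' d' where gh: "g = quat a b c d" "h = quat a' b' c' d'"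
    "a\<^sup>2 + b\<^sup>2 + c\<^sup>2 + d\<^sup>2 = 1" "a'\<^sup>2 + b'\<^sup>2 + c'\<^sup>2 + d'\<^sup>2 = 1"
    unfolding SU2_eq_quat by blast
  have "(a * a' - b * b' - c * c' - d * d')\<^sup>2 + (a * b' + b * a' + c * d' - d * c')\<^sup>2
      + (a * c' - b * d' + c * a' + d * b')\<^sup>2 + (a * d' + b * c' - c * b' + d * a')\<^sup>2
      = (a\<^sup>2 + b\<^sup>2 + c\<^sup>2 + d\<^sup>2) * (a'\<^sup>2 + b'\<^sup>2 + c'\<^sup>2 + d'\<^sup>2)"
    by algebra
  then show ?thesis using gh by (simp add: quat_mult quat_in_SU2)
qed

lemma SU2_one: "mat 1 \<in> SU2"
  by (simp add: quat_one quat_in_SU2)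

lemma SU2_hconj: "g \<in> SU2 \<Longrightarrow> hconj g \<in> SU2 \<and> hconj g ** g = mat 1 \<and> g ** hconj g = mat 1"
  by (auto simp: SU2_eq_quat hconj_quat quat_mult quat_one quat_eq_iff power2_eq_square)

lemma norm_quat: "(norm (quat a b c d))\<^sup>2 = 2 * (a\<^sup>2 + b\<^sup>2 + c\<^sup>2 + d\<^sup>2)"
  by (simp add: norm_vec_def L2_set_def sum_2 quat_def complex_norm real_sqrt_pow2)

text \<open>The imaginary part \<open>X\<close> of the quaternion has length \<open>r\<close> and satisfies \<open>X\<^sup>2 = -r\<^sup>2\<close>, so
  \<open>X (X + r E\<^sub>3) = (X + r E\<^sub>3) (r E\<^sub>3)\<close>.  Normalising \<open>X + r E\<^sub>3\<close> gives the conjugating element;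
  in the degenerate case \<open>X = -r E\<^sub>3\<close> the element \<open>E\<^sub>1\<close> does the job.\<close>

lemma SU2_conj_torus:
  assumes "quat a b c d \<in> SU2"
  shows "\<exists>h\<in>SU2. quat a b c d ** h = h ** quat a 0 0 (sqrt (b\<^sup>2 + c\<^sup>2 + d\<^sup>2))"
proof -
  define r where "r = sqrt (b\<^sup>2 + c\<^sup>2 + d\<^sup>2)"
  have r2: "r\<^sup>2 = b\<^sup>2 + c\<^sup>2 + d\<^sup>2" and "r \<ge> 0" by (auto simp: r_def)
  have "d\<^sup>2 \<le> r\<^sup>2" using r2 by simp
  then have "\<bar>d\<bar> \<le> r" using \<open>r \<ge> 0\<close> by (simp add: abs_le_square_iff[symmetric])
  define s where "s = sqrt (b\<^sup>2 + c\<^sup>2 + (d + r)\<^sup>2)"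
  show ?thesis
  proof (cases "s = 0")
    case True
    then have "b\<^sup>2 + c\<^sup>2 + (d + r)\<^sup>2 = 0" by (simp add: s_def)
    then have "b = 0 \<and> c = 0 \<and> d + r = 0"
      by (smt (verit) zero_le_power2 zero_less_power2)
    then have "b = 0" "c = 0" "r = - d" by auto
    then have "quat a b c d ** quat 0 1 0 0 = quat 0 1 0 0 ** quat a 0 0 r"
      by (simp add: quat_mult)
    then show ?thesis unfolding r_def by (intro bexI) (auto simp: quat_in_SU2)
  next
    case False
    then have "0 < b\<^sup>2 + c\<^sup>2 + (d + r)\<^sup>2"
      unfolding s_def by (smt (verit) real_sqrt_zero zero_le_power2)
    then have s2: "s\<^sup>2 = b\<^sup>2 + c\<^sup>2 + (d + r)\<^sup>2" and "s > 0"
      by (simp_all add: s_def)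
    then have "quat 0 (b / s) (c / s) ((d + r) / s) \<in> SU2"
      by (simp add: quat_in_SU2 power_divide s2[symmetric] flip: add_divide_distrib)
    moreover have "quat a b c d ** quat 0 (b / s) (c / s) ((d + r) / s)
        = quat 0 (b / s) (c / s) ((d + r) / s) ** quat a 0 0 r"
    proof -
      have "quat a b c d ** quat 0 b c (d + r) = quat 0 b c (d + r) ** quat a 0 0 r"
        using r2 by (simp add: quat_mult quat_eq_iff algebra_simps power2_eq_square)
      moreover have "quat 0 (b / s) (c / s) ((d + r) / s) = (1 / s) *\<^sub>R quat 0 b c (d + r)"
        by (simp add: quat_scaleR)
      ultimately show ?thesis by (simp add: mm.scaleR_left mm.scaleR_right)
    qed
    ultimately show ?thesis unfolding r_def by blast
  qed
qed

text \<open>As \<open>X\<^sup>2 = -1\<close>, the exponential series splits into the cosine and the sine series.\<close>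

lemma mat_exp_unit_quat:
  assumes "b\<^sup>2 + c\<^sup>2 + d\<^sup>2 = 1"
  shows "mat_exp (t *\<^sub>R quat 0 b c d) = quat (cos t) (b * sin t) (c * sin t) (d * sin t)"
proof -
  let ?X = "quat 0 b c d"
  have sq: "?X ** ?X = - mat 1"
    using assms by (simp add: quat_mult quat_one quat_minus quat_eq_iff power2_eq_square)
  have pow: "(1 / fact k) *\<^sub>R ((**) (t *\<^sub>R ?X) ^^ k) (mat 1)
      = (cos_coeff k *\<^sub>R t ^ k) *\<^sub>R mat 1 + (sin_coeff k *\<^sub>R t ^ k) *\<^sub>R ?X" for k
  proof -
    have "((**) (t *\<^sub>R ?X) ^^ k) (mat 1) = (t ^ k) *\<^sub>R (if even k then (-1) ^ (k div 2) *\<^sub>R mat 1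
        else (-1) ^ (k div 2) *\<^sub>R ?X)"
      by (induction k) (auto simp: mm.scaleR_left mm.scaleR_right sq elim!: oddE evenE)
    then show ?thesis
      by (auto simp: cos_coeff_def sin_coeff_def elim!: oddE)
  qed
  have "(\<lambda>k. (1 / fact k) *\<^sub>R ((**) (t *\<^sub>R ?X) ^^ k) (mat 1)) sums (cos t *\<^sub>R mat 1 + sin t *\<^sub>R ?X)"
    unfolding pow
    by (intro sums_add bounded_linear.sums[OF bounded_linear_scaleR_left] cos_converges sin_converges)
  then have "mat_exp (t *\<^sub>R ?X) = cos t *\<^sub>R mat 1 + sin t *\<^sub>R ?X"
    unfolding mat_exp_def by (rule sums_unique[symmetric])
  then show ?thesis by (simp add: quat_one quat_scaleR quat_add mult_ac)
qed

section \<open>Differentiating a unitary representation\<close>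

lemma has_vector_derivative_affine:
  fixes f :: "real \<Rightarrow> 'a::real_normed_vector"
  assumes "(f has_vector_derivative D) (at (a + r * t))"
  shows "((\<lambda>t. f (a + r * t)) has_vector_derivative r *\<^sub>R D) (at t)"
proof -
  have "((\<lambda>t. a + r * t) has_vector_derivative r) (at t)"
    unfolding has_vector_derivative_def by (auto intro!: derivative_eq_intros simp: mult.commute)
  from vector_diff_chain_at[OF this assms] show ?thesis by (simp add: o_def)
qed

lemma has_vector_derivative_at_0_iff:
  fixes f :: "real \<Rightarrow> 'a::real_normed_vector"
  shows "(f has_vector_derivative D) (at 0) \<longleftrightarrow>
    (\<forall>e>0. \<exists>d>0. \<forall>t. \<bar>t\<bar> < d \<longrightarrow> norm (f t - f 0 - t *\<^sub>R D) \<le> e * \<bar>t\<bar>)"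
  by (simp add: has_vector_derivative_def has_derivative_at_alt bounded_linear_scaleR_left)

lemma has_vector_derivative_imp_quotient:
  fixes f :: "real \<Rightarrow> 'a::real_normed_vector"
  assumes "(f has_vector_derivative D) (at 0)"
  shows "((\<lambda>h. (1 / h) *\<^sub>R (f h - f 0)) \<longlongrightarrow> D) (at 0)"
proof -
  have "((\<lambda>h. norm (f h - f 0 - h *\<^sub>R D) / norm h) \<longlongrightarrow> 0) (at 0)"
    using assms by (simp add: has_vector_derivative_def has_derivative_at)
  moreover have "\<forall>\<^sub>F h in at 0. norm (f h - f 0 - h *\<^sub>R D) / norm h = norm ((1 / h) *\<^sub>R (f h - f 0) - D)"
  proof -
    have "norm (f h - f 0 - h *\<^sub>R D) / norm h = norm ((1 / h) *\<^sub>R (f h - f 0) - D)" if "h \<noteq> 0" for h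
    proof -
      have "(1 / h) *\<^sub>R (f h - f 0) - D = (1 / h) *\<^sub>R (f h - f 0 - h *\<^sub>R D)"
        using that by (simp add: scaleR_diff_right)
      then show ?thesis by simp
    qed
    then show ?thesis by (simp add: eventually_at_filter)
  qed
  ultimately have "((\<lambda>h. norm ((1 / h) *\<^sub>R (f h - f 0) - D)) \<longlongrightarrow> 0) (at 0)"
    by (rule Lim_transform_eventually)
  then show ?thesis by (simp add: tendsto_norm_zero_iff LIM_zero_iff)
qed

text \<open>For an antiderivative \<open>F\<close> of \<open>\<phi>\<close> the group law gives
  \<open>\<phi> t ** (F \<epsilon> - F 0) = F (t + \<epsilon>) - F t\<close>.  The right-hand side is differentiable in \<open>t\<close>, and the
  factor \<open>F \<epsilon> - F 0\<close> is invertible for small \<open>\<epsilon>\<close>, its quotient by \<open>\<epsilon>\<close> being close to \<open>\<phi> 0 = 1\<close>.\<close>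

lemma one_parameter_group_differentiable:
  fixes \<phi> :: "real \<Rightarrow> complex^'d^'d"
  assumes cont: "continuous_on UNIV \<phi>"
    and hom: "\<And>s t. \<phi> (s + t) = \<phi> s ** \<phi> t" and one: "\<phi> 0 = mat 1"
  shows "\<exists>A. (\<phi> has_vector_derivative A) (at 0)"
proof -
  obtain F where F: "\<And>x. x \<in> {-2..2} \<Longrightarrow> (F has_vector_derivative \<phi> x) (at x within {-2..2})"
    using antiderivative_continuous[of "-2" 2 \<phi>] continuous_on_subset[OF cont] by blast
  have F': "(F has_vector_derivative \<phi> x) (at x)" if "\<bar>x\<bar> < 2" for x
    using F[of x] that at_within_Icc_at[of "-2" x 2] by (auto simp: abs_less_iff)
  have shift: "\<phi> t ** (F \<epsilon> - F 0) = F (t + \<epsilon>) - F t" if "\<bar>t\<bar> < 1" "0 < \<epsilon>" "\<epsilon> < 1" for t \<epsilon>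
  proof -
    have "\<exists>c. \<forall>s\<in>{-1<..<1}. F (t + s) - \<phi> t ** F s = c"
    proof (rule has_vector_derivative_zero_constant)
      fix s :: real assume s: "s \<in> {-1<..<1}"
      have s2: "\<bar>s\<bar> < 2" "\<bar>t + s\<bar> < 2" using s that by (auto simp: abs_less_iff)
      have "((\<lambda>s. F (t + s)) has_vector_derivative \<phi> (t + s)) (at s)"
        using has_vector_derivative_affine[of F "\<phi> (t + s)" t 1 s] F'[OF s2(2)] by simp
      moreover have "((\<lambda>s. \<phi> t ** F s) has_vector_derivative \<phi> t ** \<phi> s) (at s)"
        by (rule bounded_linear.has_vector_derivative[OF mm.bounded_linear_right F'[OF s2(1)]])
      ultimately have "((\<lambda>s. F (t + s) - \<phi> t ** F s) has_vector_derivative 0) (at s)"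
        using has_vector_derivative_diff hom by fastforce
      then show "((\<lambda>s. F (t + s) - \<phi> t ** F s) has_vector_derivative 0) (at s within {-1<..<1})"
        by (rule has_vector_derivative_at_within)
    qed (simp, blast)
    then obtain c where c: "\<And>s. s \<in> {-1<..<1} \<Longrightarrow> F (t + s) - \<phi> t ** F s = c" by blast
    from c[of 0] c[of \<epsilon>] that show ?thesis by (simp add: mm.diff_right algebra_simps)
  qed
  define N where "N \<epsilon> = (1 / \<epsilon>) *\<^sub>R (F \<epsilon> - F 0)" for \<epsilon>
  have "(N \<longlongrightarrow> mat 1) (at 0)"
    using has_vector_derivative_imp_quotient[OF F'[of 0]] by (simp add: N_def[abs_def] one)
  then have "((\<lambda>\<epsilon>. det (N \<epsilon>)) \<longlongrightarrow> det (mat 1 :: complex^'d^'d)) (at 0)"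
    unfolding det_def by (intro tendsto_intros)
  then have "\<forall>\<^sub>F \<epsilon> in at 0. det (N \<epsilon>) \<noteq> 0"
    by (rule tendsto_imp_eventually_ne) simp
  then have "\<forall>\<^sub>F \<epsilon> in at_right 0. det (N \<epsilon>) \<noteq> 0"
    by (simp add: eventually_at_split)
  moreover have "\<forall>\<^sub>F \<epsilon> in at_right 0. 0 < \<epsilon> \<and> \<epsilon> < (1::real)"
    by (rule eventually_at_rightI[of 0 1]) auto
  ultimately have "\<forall>\<^sub>F \<epsilon> in at_right 0. det (N \<epsilon>) \<noteq> 0 \<and> 0 < \<epsilon> \<and> \<epsilon> < 1"
    by (rule eventually_conj)
  then obtain \<epsilon> where \<epsilon>: "det (N \<epsilon>) \<noteq> 0" "0 < \<epsilon>" "\<epsilon> < 1"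
    by (metis (mono_tags, lifting) eventually_happens trivial_limit_at_right_real)
  then obtain N' where N': "N \<epsilon> ** N' = mat 1"
    using invertible_det_nz invertible_right_inverse by blast
  define \<psi> where "\<psi> t = ((1 / \<epsilon>) *\<^sub>R (F (t + \<epsilon>) - F t)) ** N'" for t
  have "\<psi> t = \<phi> t" if "\<bar>t\<bar> < 1" for t
    using shift[OF that \<epsilon>(2,3)] N'
    by (metis N_def \<psi>_def matrix_mul_assoc matrix_mul_rid mm.scaleR_right)
  then have ev: "\<And>t. t \<in> {-1<..<1} \<Longrightarrow> \<psi> t = \<phi> t" by auto
  have "((\<lambda>t. F (t + \<epsilon>)) has_vector_derivative \<phi> \<epsilon>) (at 0)"
    using has_vector_derivative_affine[of F "\<phi> \<epsilon>" \<epsilon> 1 0] F'[of \<epsilon>] \<epsilon> by (simp add: add.commute)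
  then have "((\<lambda>t. (1 / \<epsilon>) *\<^sub>R (F (t + \<epsilon>) - F t)) has_vector_derivative (1 / \<epsilon>) *\<^sub>R (\<phi> \<epsilon> - \<phi> 0)) (at 0)"
    using F'[of 0] by (intro bounded_linear.has_vector_derivative[OF bounded_linear_scaleR_right]
        has_vector_derivative_diff) auto
  then have "(\<psi> has_vector_derivative ((1 / \<epsilon>) *\<^sub>R (\<phi> \<epsilon> - \<phi> 0)) ** N') (at 0)"
    unfolding \<psi>_def by (rule bounded_linear.has_vector_derivative[OF mm.bounded_linear_left])
  then have "(\<phi> has_vector_derivative ((1 / \<epsilon>) *\<^sub>R (\<phi> \<epsilon> - \<phi> 0)) ** N') (at 0)"
    by (rule has_vector_derivative_transform_within_open[where S = "{-1<..<1}"]) (use ev in auto)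
  then show ?thesis by blast
qed

text \<open>The one-parameter group generated by \<open>P\<close> whenever \<open>P\<^sup>2 = -1\<close>.\<close>

definition rotor :: "complex^2^2 \<Rightarrow> real \<Rightarrow> complex^2^2" where
  "rotor P t = cos t *\<^sub>R mat 1 + sin t *\<^sub>R P"

definition pure_unit :: "complex^2^2 \<Rightarrow> bool" where
  "pure_unit P \<longleftrightarrow> (\<exists>b c d. P = quat 0 b c d \<and> b\<^sup>2 + c\<^sup>2 + d\<^sup>2 = 1)"

lemma pure_unit_quat: "b\<^sup>2 + c\<^sup>2 + d\<^sup>2 = 1 \<Longrightarrow> pure_unit (quat 0 b c d)"
  unfolding pure_unit_def by blast

lemma pure_unit_su2E: "j \<in> {1..3} \<Longrightarrow> pure_unit (su2E j)"
proof -
  assume "j \<in> {1..3}"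
  then have "j = 1 \<or> j = 2 \<or> j = 3" by auto
  then show ?thesis by (elim disjE) (simp_all add: su2E_quat pure_unit_quat)
qed

lemma pure_unit_square: "pure_unit P \<Longrightarrow> P ** P = - mat 1"
  by (auto simp: pure_unit_def quat_mult quat_one quat_minus quat_eq_iff power2_eq_square)

lemma rotor_quat: "rotor (quat a b c d) t = quat (cos t + a * sin t) (b * sin t) (c * sin t) (d * sin t)"
  by (simp add: rotor_def quat_one quat_scaleR quat_add mult_ac)

lemma mat_exp_pure_unit: "pure_unit P \<Longrightarrow> mat_exp (t *\<^sub>R P) = rotor P t"
  by (auto simp: pure_unit_def mat_exp_unit_quat rotor_quat)

lemma rotor_in_SU2: assumes "pure_unit P" shows "rotor P t \<in> SU2"
proof -
  obtain b c d where P: "P = quat 0 b c d" "b\<^sup>2 + c\<^sup>2 + d\<^sup>2 = 1"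
    using assms by (auto simp: pure_unit_def)
  have "(cos t)\<^sup>2 + (b * sin t)\<^sup>2 + (c * sin t)\<^sup>2 + (d * sin t)\<^sup>2
      = (cos t)\<^sup>2 + (b\<^sup>2 + c\<^sup>2 + d\<^sup>2) * (sin t)\<^sup>2"
    by (simp add: power_mult_distrib algebra_simps)
  then show ?thesis by (simp add: P rotor_quat quat_in_SU2)
qed

lemma rotor_0: "rotor P 0 = mat 1"
  by (simp add: rotor_def)

lemma rotor_add:
  assumes "pure_unit P" shows "rotor P (s + t) = rotor P s ** rotor P t"
  using pure_unit_square[OF assms]
  by (simp add: rotor_def mm.add_left mm.add_right mm.scaleR_left mm.scaleR_right
      cos_add sin_add algebra_simps)

lemma rotor_has_vector_derivative: "(rotor P has_vector_derivative P) (at 0)"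
  unfolding rotor_def
  by (auto intro!: derivative_eq_intros simp: has_vector_derivative_def fun_eq_iff)

lemma continuous_on_rotor: "continuous_on S (rotor P)"
  unfolding rotor_def by (intro continuous_intros)

text \<open>Polar decomposition of a unit quaternion.\<close>

lemma SU2_eq_rotor:
  assumes "g \<in> SU2" shows "\<exists>P t. pure_unit P \<and> g = rotor P t"
proof -
  obtain a b c d where g: "g = quat a b c d" "a\<^sup>2 + b\<^sup>2 + c\<^sup>2 + d\<^sup>2 = 1"
    using assms SU2_eq_quat by blast
  define r where "r = sqrt (b\<^sup>2 + c\<^sup>2 + d\<^sup>2)"
  have r: "r\<^sup>2 = b\<^sup>2 + c\<^sup>2 + d\<^sup>2" by (simp add: r_def)
  then obtain t where t: "a = cos t" "r = sin t"
    using sincos_total_2pi[of a r] g by (metis add.assoc)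
  show ?thesis
  proof (cases "r = 0")
    case True
    with r have "b = 0 \<and> c = 0 \<and> d = 0"
      by (smt (verit) zero_le_power2 zero_less_power2 zero_power2)
    then have "g = rotor (quat 0 1 0 0) t" using g t True by (simp add: rotor_quat)
    then show ?thesis using pure_unit_quat[of 1 0 0] by auto
  next
    case False
    then have "g = rotor (quat 0 (b / r) (c / r) (d / r)) t"
      using t g by (simp add: rotor_quat)
    moreover have "pure_unit (quat 0 (b / r) (c / r) (d / r))"
      using False r by (intro pure_unit_quat) (simp add: power_divide r[symmetric] flip: add_divide_distrib)
    ultimately show ?thesis by blast
  qed
qed

locale su2_rep =
  fixes U :: "complex^2^2 \<Rightarrow> complex^'d^'d"
  assumes unitary_rep: "unitary_rep U"
begin

lemma U_mult: "g \<in> SU2 \<Longrightarrow> h \<in> SU2 \<Longrightarrow> U (g ** h) = U g ** U h"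
  and U_unitary: "g \<in> SU2 \<Longrightarrow> hconj (U g) ** U g = mat 1"
  and U_continuous: "continuous_on SU2 U"
  using unitary_rep by (auto simp: unitary_rep_def)

lemma U_one: "U (mat 1) = mat 1"
proof -
  have "U (mat 1) = hconj (U (mat 1)) ** (U (mat 1) ** U (mat 1))"
    by (simp add: matrix_mul_assoc U_unitary SU2_one)
  also have "U (mat 1) ** U (mat 1) = U (mat 1)"
    using U_mult[OF SU2_one SU2_one] by simp
  finally show ?thesis by (simp add: U_unitary SU2_one)
qed

text \<open>The columns of a unitary matrix are unit vectors, so all its entries have modulus at most \<open>1\<close>.\<close>

lemma U_bounded: "\<exists>B. \<forall>g\<in>SU2. norm (U g) \<le> B"
proof (intro exI ballI)
  fix g assume g: "g \<in> SU2"
  have "cmod (U g $ i $ j) \<le> 1" for i j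
  proof -
    have "(\<Sum>i\<in>UNIV. cnj (U g $ i $ j) * U g $ i $ j) = 1"
      using arg_cong[OF U_unitary[OF g], of "\<lambda>M. M $ j $ j"]
      by (simp add: matrix_matrix_mult_def hconj_def mat_def)
    then have "(\<Sum>i\<in>UNIV. (cmod (U g $ i $ j))\<^sup>2) = 1"
      by (simp add: mult.commute[of "cnj _"] complex_norm_square[symmetric] flip: of_real_power of_real_sum)
    moreover have "(cmod (U g $ i $ j))\<^sup>2 \<le> (\<Sum>i\<in>UNIV. (cmod (U g $ i $ j))\<^sup>2)"
      by (rule member_le_sum) auto
    ultimately show ?thesis by (simp add: power_le_one_iff abs_square_le_1)
  qed
  then have "norm (U g $ i) \<le> (\<Sum>j\<in>(UNIV::'d set). 1)" for i
    unfolding norm_vec_def by (intro order_trans[OF L2_set_le_sum] sum_mono) auto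
  then show "norm (U g) \<le> (\<Sum>i\<in>(UNIV::'d set). \<Sum>j\<in>(UNIV::'d set). 1)"
    unfolding norm_vec_def[of "U g"] by (intro order_trans[OF L2_set_le_sum] sum_mono) auto
qed

lemma U_rotor_differentiable:
  assumes P: "pure_unit P"
  shows "\<exists>A. ((\<lambda>t. U (rotor P t)) has_vector_derivative A) (at 0)"
proof (rule one_parameter_group_differentiable)
  show "continuous_on UNIV (\<lambda>t. U (rotor P t))"
    by (rule continuous_on_compose2[OF U_continuous continuous_on_rotor])
      (auto simp: rotor_in_SU2 P)
qed (simp_all add: rotor_add rotor_0 U_one U_mult rotor_in_SU2 P)

text \<open>Along the torus \<open>r \<mapsto> sqrt (1 - r\<^sup>2) + r E\<^sub>3\<close>, which is the one-parameter group of \<open>E\<^sub>3\<close> at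
  time \<open>arcsin r\<close>, the estimate follows from differentiability.  An arbitrary \<open>g\<close> is conjugate to
  a point of the torus, with \<open>r\<close> the length of the imaginary part of \<open>g\<close>, and conjugation by the
  bounded matrices \<open>U h\<close> changes norms by at most a constant factor.\<close>

lemma U_near_one:
  "\<exists>C \<delta>. C > 0 \<and> \<delta> > 0 \<and> (\<forall>g\<in>SU2. norm (g - mat 1) < \<delta> \<longrightarrow> norm (U g - mat 1) \<le> C * norm (g - mat 1))"
proof -
  have E3: "pure_unit (quat 0 0 0 1)" by (simp add: pure_unit_quat)
  obtain A where A: "((\<lambda>t. U (rotor (quat 0 0 0 1) t)) has_vector_derivative A) (at 0)"
    using U_rotor_differentiable[OF E3] by blast
  have "(arcsin has_vector_derivative 1) (at 0)"
    using DERIV_arcsin[of 0] by (simp add: has_real_derivative_iff_has_vector_derivative)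
  from vector_diff_chain_at[OF this, of _ A] A
  have "((\<lambda>r. U (rotor (quat 0 0 0 1) (arcsin r))) has_vector_derivative A) (at 0)"
    by (simp add: o_def)
  then obtain \<delta> where \<delta>: "\<delta> > 0" "\<And>r. \<bar>r\<bar> < \<delta> \<Longrightarrow>
      norm (U (rotor (quat 0 0 0 1) (arcsin r)) - mat 1 - r *\<^sub>R A) \<le> \<bar>r\<bar>"
    unfolding has_vector_derivative_at_0_iff by (metis arcsin_0 rotor_0 U_one zero_less_one mult_1)
  have torus: "norm (U (rotor (quat 0 0 0 1) (arcsin r)) - mat 1) \<le> (norm A + 1) * \<bar>r\<bar>" if "\<bar>r\<bar> < \<delta>" for r
    using \<delta>(2)[OF that] norm_triangle_sub[of "U (rotor (quat 0 0 0 1) (arcsin r)) - mat 1" "r *\<^sub>R A"]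
    by (simp add: algebra_simps)
  obtain B where B: "\<And>g. g \<in> SU2 \<Longrightarrow> norm (U g) \<le> B" using U_bounded by blast
  have "B \<ge> 0" using B[OF SU2_one] norm_ge_zero order_trans by blast
  obtain K where K: "K \<ge> 0" "\<And>(X :: complex^'d^'d) (Y :: complex^'d^'d). norm (X ** Y) \<le> norm X * norm Y * K"
    using mm.nonneg_bounded by blast
  \<comment> \<open>The summand \<open>1\<close> only serves to make the constant positive.\<close>
  define C where "C = B * ((norm A + 1) * B * K) * K + 1"
  have "norm (U g - mat 1) \<le> C * norm (g - mat 1)" if g: "g \<in> SU2" "norm (g - mat 1) < min \<delta> 1" for g
  proof -
    obtain a b c d where q: "g = quat a b c d" "a\<^sup>2 + b\<^sup>2 + c\<^sup>2 + d\<^sup>2 = 1"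
      using g SU2_eq_quat by blast
    define r where "r = sqrt (b\<^sup>2 + c\<^sup>2 + d\<^sup>2)"
    have r2: "r\<^sup>2 = b\<^sup>2 + c\<^sup>2 + d\<^sup>2" and "r \<ge> 0" by (auto simp: r_def)
    have "g - mat 1 = quat (a - 1) b c d"
      by (simp add: q quat_one quat_def mat2_simps)
    then have n: "(norm (g - mat 1))\<^sup>2 = 2 * ((a - 1)\<^sup>2 + r\<^sup>2)"
      by (simp add: norm_quat r2)
    have rn: "\<bar>r\<bar> \<le> norm (g - mat 1)" and an: "\<bar>a - 1\<bar> \<le> norm (g - mat 1)"
      using n by (auto intro!: abs_le_square_iff[THEN iffD2, of _ "norm _", simplified])
    then have "a > 0" "\<bar>r\<bar> < \<delta>" "\<bar>r\<bar> \<le> 1" using g by auto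
    have "a\<^sup>2 = 1 - r\<^sup>2" using q r2 by simp
    then have a: "a = sqrt (1 - r\<^sup>2)" using \<open>a > 0\<close> by (metis less_imp_le real_sqrt_abs abs_of_pos)
    define k where "k = rotor (quat 0 0 0 1) (arcsin r)"
    have k: "k = quat a 0 0 r"
      using \<open>\<bar>r\<bar> \<le> 1\<close> by (simp add: k_def rotor_quat a cos_arcsin abs_le_iff)
    have kS: "k \<in> SU2" unfolding k_def by (rule rotor_in_SU2[OF E3])
    obtain h where h: "h \<in> SU2" "g ** h = h ** k"
      using SU2_conj_torus g q unfolding k r_def by blast
    note hi = SU2_hconj[OF h(1)]
    have "U g ** U h = U h ** U k"
      using h g kS by (simp flip: U_mult)
    moreover have "U h ** U (hconj h) = mat 1"
      using hi h U_mult[OF h(1), of "hconj h"] by (simp add: U_one)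
    ultimately have "U g = U h ** U k ** U (hconj h)"
      by (metis matrix_mul_assoc matrix_mul_rid)
    then have "U g - mat 1 = U h ** ((U k - mat 1) ** U (hconj h))"
      using \<open>U h ** U (hconj h) = mat 1\<close>
      by (simp add: mm.diff_right mm.diff_left matrix_mul_assoc)
    also have "norm \<dots> \<le> norm (U h) * norm ((U k - mat 1) ** U (hconj h)) * K"
      by (rule K)
    also have "\<dots> \<le> B * (norm (U k - mat 1) * norm (U (hconj h)) * K) * K"
      using K B h \<open>B \<ge> 0\<close> by (intro mult_mono) auto
    also have "\<dots> \<le> B * (((norm A + 1) * norm (g - mat 1)) * B * K) * K"
    proof -
      have "norm (U k - mat 1) \<le> (norm A + 1) * norm (g - mat 1)"
        using torus[OF \<open>\<bar>r\<bar> < \<delta>\<close>] rn unfolding k_def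
        by (meson add_nonneg_nonneg mult_left_mono norm_ge_zero order_trans zero_le_one)
      then show ?thesis using K B hi \<open>B \<ge> 0\<close>
        by (intro mult_right_mono mult_left_mono mult_mono) auto
    qed
    also have "\<dots> \<le> C * norm (g - mat 1)"
      by (simp add: C_def algebra_simps)
    finally show ?thesis .
  qed
  moreover have "C > 0" using K \<open>B \<ge> 0\<close> by (auto simp: C_def intro!: add_nonneg_pos mult_nonneg_nonneg)
  ultimately show ?thesis using \<delta>(1) by (intro exI[of _ C] exI[of _ "min \<delta> 1"]) auto
qed

text \<open>The estimate \<open>U_near_one\<close> turns \<open>g t - 1 = o(t)\<close> into \<open>U (g t) - 1 = o(t)\<close>.\<close>

lemma U_derivative_zero:
  assumes g: "\<And>t. g t \<in> SU2" "g 0 = mat 1" "(g has_vector_derivative 0) (at (0::real))"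
  shows "((\<lambda>t. U (g t)) has_vector_derivative 0) (at 0)"
proof -
  obtain C \<delta> where C: "C > 0" "\<delta> > 0"
    "\<And>g. g \<in> SU2 \<Longrightarrow> norm (g - mat 1) < \<delta> \<Longrightarrow> norm (U g - mat 1) \<le> C * norm (g - mat 1)"
    using U_near_one by blast
  have "\<exists>d>0. \<forall>t. \<bar>t\<bar> < d \<longrightarrow> norm (U (g t) - mat 1) \<le> e * \<bar>t\<bar>" if "e > 0" for e
  proof -
    have "e / C > 0" using that C by simp
    then obtain d where d: "d > 0" "\<And>t. \<bar>t\<bar> < d \<Longrightarrow> norm (g t - mat 1) \<le> e / C * \<bar>t\<bar>"
      using g(2,3) unfolding has_vector_derivative_at_0_iff by (metis scaleR_zero_right diff_zero)
    have "norm (U (g t) - mat 1) \<le> e * \<bar>t\<bar>" if t: "\<bar>t\<bar> < min d (\<delta> * C / e)" for t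
    proof -
      have "norm (g t - mat 1) \<le> e / C * \<bar>t\<bar>" using d t by auto
      moreover have "e / C * \<bar>t\<bar> < \<delta>" using t C \<open>e > 0\<close> by (simp add: field_simps)
      ultimately have "norm (U (g t) - mat 1) \<le> C * norm (g t - mat 1)" using C g by auto
      also have "\<dots> \<le> C * (e / C * \<bar>t\<bar>)"
        using \<open>norm (g t - mat 1) \<le> e / C * \<bar>t\<bar>\<close> C by (intro mult_left_mono) auto
      finally show ?thesis using C by simp
    qed
    then show ?thesis using d C \<open>e > 0\<close> by (intro exI[of _ "min d (\<delta> * C / e)"]) auto
  qed
  then show ?thesis
    unfolding has_vector_derivative_at_0_iff by (simp add: g U_one)
qed

abbreviation A :: "nat \<Rightarrow> complex^'d^'d" where
  "A j \<equiv> inf_rep U (su2E j)"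

lemma U_rotor_su2E:
  assumes "j \<in> {1..3}"
  shows "((\<lambda>t. U (rotor (su2E j) t)) has_vector_derivative A j) (at 0)"
proof -
  note j = pure_unit_su2E[OF assms]
  then obtain M where "((\<lambda>t. U (rotor (su2E j) t)) has_vector_derivative M) (at 0)"
    using U_rotor_differentiable by blast
  then show ?thesis
    unfolding inf_rep_def mat_exp_pure_unit[OF j] using vector_derivative_at by fastforce
qed

text \<open>The differential of \<open>U\<close> at \<open>1\<close>, defined as the real linear extension of \<open>E\<^sub>j \<mapsto> A j\<close>, so that
  linearity holds by definition and \<open>U_curve\<close> is the fact to be proved.\<close>

definition dU :: "complex^2^2 \<Rightarrow> complex^'d^'d" where
  "dU X = Im (X $ 1 $ 2) *\<^sub>R A 1 - Re (X $ 1 $ 2) *\<^sub>R A 2 + Im (X $ 1 $ 1) *\<^sub>R A 3"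

lemma dU_quat: "dU (quat a b c d) = b *\<^sub>R A 1 + c *\<^sub>R A 2 + d *\<^sub>R A 3"
  by (simp add: dU_def quat_def)

lemma dU_add: "dU (X + Y) = dU X + dU Y" and dU_scaleR: "dU (r *\<^sub>R X) = r *\<^sub>R dU X"
  by (simp_all add: dU_def algebra_simps)

lemma dU_su2E: "j \<in> {1..3} \<Longrightarrow> dU (su2E j) = A j"
proof -
  assume "j \<in> {1..3}"
  then have "j = 1 \<or> j = 2 \<or> j = 3" by auto
  then show ?thesis by (elim disjE) (simp_all add: su2E_quat dU_quat)
qed

text \<open>Compare \<open>g\<close> with the product \<open>p\<close> of the one-parameter groups of \<open>b E\<^sub>1, c E\<^sub>2, d E\<^sub>3\<close>, which has
  the same velocity at \<open>0\<close>.  The quotient \<open>p\<inverse> g\<close> has velocity \<open>0\<close>, and so has its image under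
  \<open>U\<close>; for \<open>p\<close> itself the product rule applies.\<close>

lemma U_curve:
  assumes g: "\<And>t. g t \<in> SU2" "g 0 = mat 1" "(g has_vector_derivative quat 0 b c d) (at (0::real))"
  shows "((\<lambda>t. U (g t)) has_vector_derivative dU (quat 0 b c d)) (at 0)"
proof -
  have scale: "((\<lambda>t. f (r * t)) has_vector_derivative r *\<^sub>R D) (at 0)"
    if "(f has_vector_derivative D) (at 0)" for r and f :: "real \<Rightarrow> 'v::real_normed_vector" and D
    using has_vector_derivative_affine[of f D 0 r 0] that by simp
  define R where "R j r t = rotor (su2E j) (r * t)" for j r t
  have RS: "R j r t \<in> SU2" if "j \<in> {1..3}" for j r t
    unfolding R_def by (rule rotor_in_SU2[OF pure_unit_su2E[OF that]])
  have R0: "R j r 0 = mat 1" for j r by (simp add: R_def rotor_0)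
  have R': "(R j r has_vector_derivative r *\<^sub>R su2E j) (at 0)" for j r
    unfolding R_def by (rule scale[OF rotor_has_vector_derivative])
  have UR': "((\<lambda>t. U (R j r t)) has_vector_derivative r *\<^sub>R A j) (at 0)" if "j \<in> {1..3}" for j r
    unfolding R_def by (rule scale[OF U_rotor_su2E[OF that]])
  have prod: "((\<lambda>t. f t ** h t) has_vector_derivative D + E) (at 0)"
    if "(f has_vector_derivative D) (at 0)" "(h has_vector_derivative E) (at 0)"
      "f 0 = mat 1" "h 0 = mat 1" for f h :: "real \<Rightarrow> complex^'n^'n" and D E
    using mm.has_vector_derivative[OF that(1,2)] that(3,4) by (simp add: add.commute)
  define p where "p t = R 1 b t ** R 2 c t ** R 3 d t" for t
  have pS: "p t \<in> SU2" and p0: "p 0 = mat 1" for t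
    by (simp_all add: p_def SU2_mult RS R0)
  have p': "(p has_vector_derivative b *\<^sub>R su2E 1 + c *\<^sub>R su2E 2 + d *\<^sub>R su2E 3) (at 0)"
    unfolding p_def by (intro prod R') (simp_all add: R0)
  have "((\<lambda>t. U (R 1 b t) ** U (R 2 c t) ** U (R 3 d t)) has_vector_derivative
      b *\<^sub>R A 1 + c *\<^sub>R A 2 + d *\<^sub>R A 3) (at 0)"
    by (intro prod UR') (simp_all add: R0 U_one)
  then have Up': "((\<lambda>t. U (p t)) has_vector_derivative dU (quat 0 b c d)) (at 0)"
    by (simp add: p_def U_mult SU2_mult RS dU_quat)
  have bl: "bounded_linear (hconj :: complex^2^2 \<Rightarrow> _)"
    unfolding linear_conv_bounded_linear[symmetric]
    by (auto intro!: linearI simp: hconj_def vec_eq_iff complex_eq_iff)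
  define k where "k t = hconj (p t) ** g t" for t
  have "(k has_vector_derivative
      hconj (b *\<^sub>R su2E 1 + c *\<^sub>R su2E 2 + d *\<^sub>R su2E 3) + quat 0 b c d) (at 0)"
    unfolding k_def
    by (intro prod bounded_linear.has_vector_derivative[OF bl p'] g)
      (simp_all add: p0 quat_one hconj_quat g)
  then have k': "(k has_vector_derivative 0) (at 0)"
    by (simp add: su2E_quat quat_scaleR quat_add hconj_quat quat_zero)
  have kS: "k t \<in> SU2" for t by (simp add: k_def SU2_mult SU2_hconj pS g)
  have k0: "k 0 = mat 1" using SU2_hconj[OF SU2_one] by (simp add: k_def p0 g)
  have "g t = p t ** k t" for t
    using SU2_hconj[OF pS, of t] by (simp add: k_def matrix_mul_assoc)
  moreover have "((\<lambda>t. U (p t) ** U (k t)) has_vector_derivative dU (quat 0 b c d) + 0) (at 0)"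
    by (intro prod Up' U_derivative_zero kS k0 k') (simp_all add: p0 k0 U_one)
  ultimately show ?thesis by (simp add: U_mult pS kS)
qed

lemma U_rotor:
  assumes "pure_unit P" shows "((\<lambda>t. U (rotor P t)) has_vector_derivative dU P) (at 0)"
proof -
  obtain b c d where "P = quat 0 b c d" using assms by (auto simp: pure_unit_def)
  then show ?thesis
    using U_curve[of "rotor P" b c d] rotor_in_SU2[OF assms] rotor_0 rotor_has_vector_derivative by metis
qed

text \<open>Conjugating \<open>rotor Q t\<close> by \<open>rotor P s\<close> rotates \<open>Q\<close> by the angle \<open>2s\<close> in the plane of \<open>Q\<close> and
  \<open>P ** Q\<close>.  Applying \<open>U\<close>, differentiating at \<open>t = 0\<close> and then at \<open>s = 0\<close> gives the claim.\<close>

lemma dU_commutator: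
  assumes PQ: "pure_unit P" "pure_unit Q" "pure_unit (P ** Q)" "Q ** P = - (P ** Q)"
  shows "commutator (dU P) (dU Q) = 2 *\<^sub>R dU (P ** Q)"
proof -
  let ?R = "P ** Q"
  have conj: "rotor P s ** rotor Q t ** rotor P (- s) =
      cos t *\<^sub>R mat 1 + sin t *\<^sub>R (cos (2 * s) *\<^sub>R Q + sin (2 * s) *\<^sub>R ?R)" for s t
  proof -
    have "Q ** rotor P (- s) = rotor P s ** Q"
      by (simp add: rotor_def mm.add_left mm.diff_right mm.scaleR_left mm.scaleR_right PQ)
    then have "rotor P s ** Q ** rotor P (- s) = rotor P (s + s) ** Q"
      unfolding rotor_add[OF PQ(1)] by (metis matrix_mul_assoc)
    also have "\<dots> = cos (2 * s) *\<^sub>R Q + sin (2 * s) *\<^sub>R ?R"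
      by (simp add: rotor_def mm.add_left mm.scaleR_left)
    finally have "rotor P s ** (sin t *\<^sub>R Q) ** rotor P (- s)
        = sin t *\<^sub>R (cos (2 * s) *\<^sub>R Q + sin (2 * s) *\<^sub>R ?R)"
      by (simp add: mm.scaleR_left mm.scaleR_right)
    moreover have "rotor P s ** rotor P (- s) = mat 1"
      by (simp add: rotor_0 flip: rotor_add[OF PQ(1)])
    ultimately show ?thesis
      by (simp add: rotor_def[of Q] mm.add_left mm.add_right mm.scaleR_left mm.scaleR_right)
  qed
  obtain b c d b' c' d' where q: "Q = quat 0 b c d" "?R = quat 0 b' c' d'"
    using PQ unfolding pure_unit_def by blast
  have conj': "U (rotor P s) ** dU Q ** U (rotor P (- s)) = cos (2 * s) *\<^sub>R dU Q + sin (2 * s) *\<^sub>R dU ?R" for s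
  proof -
    let ?g = "\<lambda>t. rotor P s ** rotor Q t ** rotor P (- s)"
    let ?Z = "cos (2 * s) *\<^sub>R Q + sin (2 * s) *\<^sub>R ?R"
    have Z: "?Z = quat 0 (cos (2 * s) * b + sin (2 * s) * b') (cos (2 * s) * c + sin (2 * s) * c')
        (cos (2 * s) * d + sin (2 * s) * d')"
      unfolding q(2) unfolding q(1) by (simp add: quat_scaleR quat_add)
    have S: "?g t \<in> SU2" for t by (simp add: SU2_mult rotor_in_SU2 PQ)
    have g: "?g = rotor ?Z" by (rule ext) (simp only: conj rotor_def[of ?Z])
    have "((\<lambda>t. U (?g t)) has_vector_derivative dU ?Z) (at 0)"
      unfolding Z
    proof (rule U_curve[OF S])
      show "?g 0 = mat 1" using fun_cong[OF g, of 0] by (simp only: rotor_0)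
      show "(?g has_vector_derivative quat 0 (cos (2 * s) * b + sin (2 * s) * b')
          (cos (2 * s) * c + sin (2 * s) * c') (cos (2 * s) * d + sin (2 * s) * d')) (at 0)"
        unfolding g Z[symmetric] by (rule rotor_has_vector_derivative)
    qed
    moreover have "((\<lambda>t. U (rotor P s) ** U (rotor Q t) ** U (rotor P (- s)))
        has_vector_derivative U (rotor P s) ** dU Q ** U (rotor P (- s))) (at 0)"
      by (intro bounded_linear.has_vector_derivative[OF mm.bounded_linear_left]
          bounded_linear.has_vector_derivative[OF mm.bounded_linear_right] U_rotor PQ)
    moreover have "(\<lambda>t. U (rotor P s) ** U (rotor Q t) ** U (rotor P (- s))) = (\<lambda>t. U (?g t))"
      by (simp add: U_mult SU2_mult rotor_in_SU2 PQ)
    ultimately have "U (rotor P s) ** dU Q ** U (rotor P (- s)) = dU ?Z"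
      using vector_derivative_unique_at by metis
    also have "\<dots> = cos (2 * s) *\<^sub>R dU Q + sin (2 * s) *\<^sub>R dU ?R"
      by (simp add: dU_add dU_scaleR)
    finally show ?thesis .
  qed
  have m: "((\<lambda>s. U (rotor P (- s))) has_vector_derivative - dU P) (at 0)"
    using has_vector_derivative_affine[of "\<lambda>s. U (rotor P s)" "dU P" 0 "-1" 0] U_rotor[OF PQ(1)] by simp
  have "((\<lambda>s. U (rotor P s) ** dU Q ** U (rotor P (- s))) has_vector_derivative
      dU P ** dU Q - dU Q ** dU P) (at 0)"
    using mm.has_vector_derivative[OF bounded_linear.has_vector_derivative[OF mm.bounded_linear_left
        U_rotor[OF PQ(1)], of "dU Q"] m]
    by (simp add: rotor_0 U_one mm.minus_right)
  moreover have "((\<lambda>s. cos (2 * s) *\<^sub>R dU Q + sin (2 * s) *\<^sub>R dU ?R) has_vector_derivative 2 *\<^sub>R dU ?R) (at 0)"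
    by (auto intro!: derivative_eq_intros simp: has_vector_derivative_def fun_eq_iff)
  ultimately show ?thesis
    unfolding conj' commutator_def by (rule vector_derivative_unique_at)
qed

lemma A_commutators:
  "commutator (A 1) (A 2) = 2 *\<^sub>R A 3" "commutator (A 2) (A 3) = 2 *\<^sub>R A 1"
  "commutator (A 3) (A 1) = 2 *\<^sub>R A 2"
proof -
  have "commutator (dU (su2E i)) (dU (su2E j)) = 2 *\<^sub>R dU (su2E k)"
    if "i \<in> {1..3}" "j \<in> {1..3}" "k \<in> {1..3}" "su2E i ** su2E j = su2E k" "su2E j ** su2E i = - su2E k" for i j k
    using dU_commutator[of "su2E i" "su2E j"] that by (simp add: pure_unit_su2E)
  note dU = this
  have "su2E 1 ** su2E 2 = su2E 3" "su2E 2 ** su2E 1 = - su2E 3" "su2E 2 ** su2E 3 = su2E 1"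
    "su2E 3 ** su2E 2 = - su2E 1" "su2E 3 ** su2E 1 = su2E 2" "su2E 1 ** su2E 3 = - su2E 2"
    by (simp_all add: su2E_quat quat_mult quat_minus)
  with dU[of 1 2 3] dU[of 2 3 1] dU[of 3 1 2]
  show "commutator (A 1) (A 2) = 2 *\<^sub>R A 3" "commutator (A 2) (A 3) = 2 *\<^sub>R A 1"
    "commutator (A 3) (A 1) = 2 *\<^sub>R A 2"
    by (simp_all add: dU_su2E)
qed

end

section \<open>Invariant subspaces\<close>

context su2_rep
begin

lemma U_rotor_at:
  assumes P: "pure_unit P"
  shows "((\<lambda>t. U (rotor P t)) has_vector_derivative U (rotor P t) ** dU P) (at t)"
proof -
  have "((\<lambda>s. U (rotor P (- t + 1 * s))) has_vector_derivative 1 *\<^sub>R dU P) (at t)"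
    using U_rotor[OF P] by (intro has_vector_derivative_affine) simp
  then have "((\<lambda>s. U (rotor P t) ** U (rotor P (- t + 1 * s))) has_vector_derivative
      U (rotor P t) ** (1 *\<^sub>R dU P)) (at t)"
    by (rule bounded_linear.has_vector_derivative[OF mm.bounded_linear_right])
  moreover have "U (rotor P t) ** U (rotor P (- t + 1 * s)) = U (rotor P s)" for s
    using P by (simp add: rotor_in_SU2 flip: U_mult rotor_add)
  ultimately show ?thesis by simp
qed

text \<open>If \<open>z\<close> is orthogonal to \<open>W\<close>, all derivatives of \<open>t \<mapsto> z \<bullet> U (rotor P t) w\<close> vanish at \<open>0\<close>, and
  the \<open>m\<close>-th one grows at most like \<open>q\<^sup>m\<close>.  By Taylor's formula the function is zero.\<close>

lemma invariant_subspace: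
  assumes W: "vec.subspace W" and inv: "\<And>j w. j \<in> {1..3} \<Longrightarrow> w \<in> W \<Longrightarrow> A j *v w \<in> W"
    and g: "g \<in> SU2" and w: "w \<in> W"
  shows "U g *v w \<in> W"
proof -
  have scaleR: "r *\<^sub>R v = complex_of_real r *s v" for r and v :: "complex^'d"
    by (simp add: vec_eq_iff scaleR_conv_of_real[where 'a=complex])
  have sub: "subspace W"
    using W by (auto simp: subspace_def vec.subspace_def scaleR)
  obtain P t where P: "pure_unit P" and gP: "g = rotor P t"
    using SU2_eq_rotor[OF g] by blast
  let ?M = "dU P"
  obtain b c d where "P = quat 0 b c d" using P by (auto simp: pure_unit_def)
  then have M: "?M *v v \<in> W" if "v \<in> W" for v
    using inv[OF _ that] sub
    by (simp add: dU_quat mv.add_left mv.scaleR_left subspace_add subspace_scale)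
  define u where "u m = (((*v) ?M) ^^ m) w" for m
  have uW: "u m \<in> W" for m
    by (induction m) (simp_all add: u_def w M)
  \<comment> \<open>The orthogonal decomposition refers to the real inner product, for which \<open>W\<close> is a real subspace.\<close>
  obtain y z where y: "y \<in> span W" and z: "\<And>v. v \<in> span W \<Longrightarrow> orthogonal z v" and yz: "U g *v w = y + z"
    using orthogonal_subspace_decomp_exists by metis
  have zW: "z \<bullet> v = 0" if "v \<in> W" for v
    using z[of v] that by (simp add: orthogonal_def span_base)
  define D where "D m t = z \<bullet> (U (rotor P t) *v u m)" for m t
  have D': "DERIV (D m) t :> D (Suc m) t" for m t
  proof -
    have "((\<lambda>t. z \<bullet> (U (rotor P t) *v u m)) has_vector_derivative
        z \<bullet> ((U (rotor P t) ** ?M) *v u m)) (at t)"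
      by (intro bounded_linear.has_vector_derivative[OF bounded_linear_inner_right]
          bounded_linear.has_vector_derivative[OF mv.bounded_linear_left] U_rotor_at P)
    then show ?thesis
      by (simp add: D_def[abs_def] u_def matrix_vector_mul_assoc has_real_derivative_iff_has_vector_derivative)
  qed
  have D0: "D m 0 = 0" for m
    by (simp add: D_def rotor_0 U_one zW uW)
  obtain B where B: "\<And>g. g \<in> SU2 \<Longrightarrow> norm (U g) \<le> B" using U_bounded by blast
  obtain K where K: "K \<ge> 0" "\<And>(X :: complex^'d^'d) (v :: complex^'d). norm (X *v v) \<le> norm X * norm v * K"
    using mv.nonneg_bounded by blast
  define q where "q = norm ?M * K"
  have "q \<ge> 0" using K by (simp add: q_def)
  have un: "norm (u m) \<le> q ^ m * norm w" for m
  proof (induction m)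
    case (Suc m)
    have "norm (u (Suc m)) \<le> q * norm (u m)"
      using K(2)[of ?M "u m"] by (simp add: u_def q_def mult_ac)
    also have "\<dots> \<le> q * (q ^ m * norm w)"
      using Suc \<open>q \<ge> 0\<close> by (rule mult_left_mono)
    finally show ?case by simp
  qed (simp add: u_def)
  define C where "C = norm z * (B * norm w * K)"
  have Db: "\<bar>D m s\<bar> \<le> C * q ^ m" for m s
  proof -
    have "\<bar>D m s\<bar> \<le> norm z * norm (U (rotor P s) *v u m)"
      unfolding D_def by (rule Cauchy_Schwarz_ineq2)
    also have "norm (U (rotor P s) *v u m) \<le> norm (U (rotor P s)) * norm (u m) * K" by (rule K)
    also have "\<dots> \<le> B * (q ^ m * norm w) * K"
      using B[OF rotor_in_SU2[OF P, of s]] un[of m] K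
      by (intro mult_right_mono mult_mono) (auto intro: order_trans[OF norm_ge_zero])
    finally have "\<bar>D m s\<bar> \<le> norm z * (B * (q ^ m * norm w) * K)"
      by (simp add: mult_left_mono)
    then show ?thesis by (simp add: C_def mult_ac)
  qed
  have bound: "\<bar>D 0 t\<bar> \<le> C * (inverse (fact m) * (q * \<bar>t\<bar>) ^ m)" for m
  proof -
    obtain s where "D 0 t = (\<Sum>k<m. (D k 0 / fact k) * t ^ k) + (D m s / fact m) * t ^ m"
      using Maclaurin_all_le[of D "D 0" t m] D' by blast
    then have "\<bar>D 0 t\<bar> = \<bar>D m s\<bar> * \<bar>t\<bar> ^ m / fact m"
      by (simp add: D0 abs_mult power_abs)
    also have "\<dots> \<le> C * q ^ m * \<bar>t\<bar> ^ m / fact m"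
      using Db by (intro divide_right_mono mult_right_mono) auto
    finally show ?thesis by (simp add: power_mult_distrib field_simps)
  qed
  have "(\<lambda>m. C * (inverse (fact m) * (q * \<bar>t\<bar>) ^ m)) \<longlonglongrightarrow> C * 0"
    by (intro tendsto_intros summable_LIMSEQ_zero summable_exp)
  then have "\<bar>D 0 t\<bar> \<le> C * 0"
    using bound by (intro LIMSEQ_le_const) auto
  then have "z \<bullet> (y + z) = 0"
    by (simp add: D_def u_def gP[symmetric] yz)
  moreover have "z \<bullet> y = 0" using z[OF y] by (simp add: orthogonal_def)
  ultimately have "z = 0" by (simp add: inner_add_right)
  then show ?thesis using yz y sub by (metis add_0_right span_eq_iff)
qed

end

section \<open>Highest weight vectors of \<open>sl(2)\<close>\<close>

text \<open>The scalar multiplication is a parameter because the triple acts both on vectors and, by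
  commutators, on matrices, for which the scalar multiplication is \<open>mscale\<close>.\<close>

locale sl2_triple = vector_space scale for scale :: "complex \<Rightarrow> 'v::ab_group_add \<Rightarrow> 'v" +
  fixes e f h :: "'v \<Rightarrow> 'v"
  assumes lin: "Vector_Spaces.linear scale scale e" "Vector_Spaces.linear scale scale f"
      "Vector_Spaces.linear scale scale h"
    and he: "h (e v) = e (h v) + scale 2 (e v)"
    and hf: "h (f v) = f (h v) - scale 2 (f v)"
    and ef: "e (f v) = f (e v) + h v"
begin

sublocale e: Vector_Spaces.linear scale scale e by (rule lin)
sublocale f: Vector_Spaces.linear scale scale f by (rule lin)
sublocale h: Vector_Spaces.linear scale scale h by (rule lin)

definition string :: "'v \<Rightarrow> nat \<Rightarrow> 'v" where
  "string v k = (f ^^ k) v"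

lemma string_0: "string v 0 = v" and string_Suc: "string v (Suc k) = f (string v k)"
  by (simp_all add: string_def)

context
  fixes v :: 'v and m :: nat
  assumes highest: "e v = 0" and weight: "h v = scale (of_nat m) v" and nonzero: "v \<noteq> 0"
begin

lemma h_string: "h (string v k) = scale (of_nat m - 2 * of_nat k) (string v k)"
proof (induction k)
  case (Suc k)
  have "h (string v (Suc k)) = scale (of_nat m - 2 * of_nat k) (f (string v k)) - scale 2 (f (string v k))"
    by (simp add: string_Suc hf Suc f.scale)
  also have "\<dots> = scale (of_nat m - 2 * of_nat k - 2) (string v (Suc k))"
    by (simp only: scale_left_diff_distrib string_Suc)
  finally show ?case by (simp add: algebra_simps)
qed (simp add: string_0 weight)

lemma e_string: "e (string v (Suc k)) = scale ((of_nat k + 1) * (of_nat m - of_nat k)) (string v k)"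
proof (induction k)
  case 0
  then show ?case by (simp add: string_0 string_Suc ef highest weight f.zero)
next
  case (Suc k)
  have "e (string v (Suc (Suc k))) = f (e (string v (Suc k))) + h (string v (Suc k))"
    by (simp add: string_Suc[of v "Suc k"] ef)
  also have "\<dots> = scale ((of_nat k + 1) * (of_nat m - of_nat k)) (string v (Suc k))
      + scale (of_nat m - 2 * of_nat (Suc k)) (string v (Suc k))"
    by (simp only: Suc f.scale h_string) (simp only: string_Suc)
  also have "\<dots> = scale ((of_nat k + 1) * (of_nat m - of_nat k) + (of_nat m - 2 * of_nat (Suc k))) (string v (Suc k))"
    by (rule scale_left_distrib[symmetric])
  also have "(of_nat k + 1) * (of_nat m - of_nat k) + (of_nat m - 2 * of_nat (Suc k))
      = (of_nat (Suc k) + 1) * (of_nat m - of_nat (Suc k) :: complex)"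
    by (simp add: algebra_simps)
  finally show ?case .
qed

lemma string_nonzero: "k \<le> m \<Longrightarrow> string v k \<noteq> 0"
proof (induction k)
  case (Suc k)
  have "of_nat k + 1 \<noteq> (0::complex)"
    using of_nat_neq_0[of k, where 'a = complex] by (simp add: add.commute)
  moreover have "of_nat m - of_nat k \<noteq> (0::complex)"
    using Suc.prems by simp
  ultimately have "(of_nat k + 1) * (of_nat m - of_nat k) \<noteq> (0::complex)" by simp
  then show ?case using e_string[of k] Suc by (auto simp: e.zero)
qed (simp add: string_0 nonzero)

text \<open>For \<open>k > m\<close> the coefficient \<open>(k + 1) (m - k)\<close> in \<open>e_string\<close> is not zero.  So a nonzero string
  vector beyond index \<open>m\<close> would be followed by infinitely many nonzero ones, with distinct
  eigenvalues of \<open>h\<close>.\<close>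

lemma string_end:
  assumes fin: "finite {z. \<exists>v. v \<noteq> 0 \<and> h v = scale z v}"
  shows "string v (Suc m) = 0"
proof (rule ccontr)
  assume nz: "string v (Suc m) \<noteq> 0"
  have "string v (Suc m + k) \<noteq> 0" for k
  proof (induction k)
    case (Suc k)
    have "of_nat m - of_nat (Suc (m + k)) \<noteq> (0::complex)"
      unfolding right_minus_eq of_nat_eq_iff by simp
    moreover have "of_nat (Suc (m + k)) + 1 \<noteq> (0::complex)"
      using of_nat_neq_0[of "Suc (m + k)", where 'a = complex] by (simp add: add.commute)
    ultimately show ?case using e_string[of "Suc (m + k)"] Suc by (auto simp: e.zero)
  qed (use nz in simp)
  then have "range (\<lambda>k. of_nat m - 2 * of_nat (Suc m + k)) \<subseteq> {z. \<exists>v. v \<noteq> 0 \<and> h v = scale z v}"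
    using h_string by blast
  moreover have "inj (\<lambda>k. of_nat m - 2 * of_nat (Suc m + k) :: complex)"
    by (auto simp: inj_on_def)
  ultimately show False
    using fin finite_subset range_inj_infinite by blast
qed

end

end

section \<open>Eigenbases\<close>

text \<open>For a new vector \<open>w j\<close>, apply \<open>g - \<mu> j\<close> to a linear relation: this removes \<open>w j\<close> and
  multiplies the other coefficients by the nonzero numbers \<open>\<mu> i - \<mu> j\<close>.\<close>

lemma (in vector_space) eigenvectors_independent:
  assumes g: "Vector_Spaces.linear scale scale g" and "finite I" "inj_on \<mu> I"
    and ev: "\<And>i. i \<in> I \<Longrightarrow> g (w i) = scale (\<mu> i) (w i) \<and> w i \<noteq> 0"
    and "(\<Sum>i\<in>I. scale (c i) (w i)) = 0" "i \<in> I"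
  shows "c i = 0"
proof -
  interpret g: Vector_Spaces.linear scale scale g by (rule g)
  have "\<forall>i\<in>I. c i = 0"
    using assms(2,3) ev assms(5)
  proof (induction I arbitrary: c)
    case (insert j I)
    have s: "scale (c j) (w j) + (\<Sum>i\<in>I. scale (c i) (w i)) = 0"
      using insert by simp
    then have "g (scale (c j) (w j) + (\<Sum>i\<in>I. scale (c i) (w i))) = 0" by (simp add: g.zero)
    then have "scale (\<mu> j) (scale (c j) (w j)) + (\<Sum>i\<in>I. scale (c i * \<mu> i) (w i)) = 0"
      using insert by (simp add: g.add g.scale g.sum mult_ac)
    moreover have "scale (\<mu> j) (scale (c j) (w j)) + scale (\<mu> j) (\<Sum>i\<in>I. scale (c i) (w i)) = 0"
      by (simp only: s scale_zero_right flip: scale_right_distrib)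
    ultimately have "(\<Sum>i\<in>I. scale (c i * \<mu> i) (w i)) - scale (\<mu> j) (\<Sum>i\<in>I. scale (c i) (w i)) = 0"
      by (metis add_left_cancel diff_self)
    moreover have "scale (c i * (\<mu> i - \<mu> j)) (w i) = scale (c i * \<mu> i) (w i) - scale (\<mu> j) (scale (c i) (w i))" for i
      by (simp add: right_diff_distrib scale_left_diff_distrib mult.commute)
    ultimately have "(\<Sum>i\<in>I. scale (c i * (\<mu> i - \<mu> j)) (w i)) = 0"
      by (simp only: sum_subtractf scale_sum_right)
    then have "\<forall>i\<in>I. c i * (\<mu> i - \<mu> j) = 0"
      using insert by (intro insert.IH) auto
    moreover have "\<mu> i \<noteq> \<mu> j" if "i \<in> I" for i
      using insert.prems(1) insert.hyps(2) that by (auto simp: inj_on_def)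
    ultimately have *: "\<forall>i\<in>I. c i = 0" by simp
    with s have "scale (c j) (w j) = 0" by simp
    moreover have "w j \<noteq> 0" using insert.prems(2) by blast
    ultimately show ?case using * by simp
  qed simp
  then show ?thesis using assms by blast
qed

text \<open>Stated for the family rather than for its range, so that repetitions count as dependence.\<close>

definition independent_family :: "'i set \<Rightarrow> ('i \<Rightarrow> complex^'m) \<Rightarrow> bool" where
  "independent_family I w \<longleftrightarrow> (\<forall>c. (\<Sum>i\<in>I. c i *s w i) = 0 \<longrightarrow> (\<forall>i\<in>I. c i = 0))"

lemma independent_family_imp:
  assumes I: "finite I" and w: "independent_family I w"
  shows "inj_on w I" and "vec.independent (w ` I)" and "vec.dim (vec.span (w ` I)) = card I"
proof -
  show inj: "inj_on w I"
  proof (rule inj_onI, rule ccontr)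
    fix i j assume ij: "i \<in> I" "j \<in> I" "w i = w j" "i \<noteq> j"
    let ?c = "\<lambda>k. if k = i then 1 else if k = j then - 1 else (0::complex)"
    have "(\<Sum>k\<in>I. ?c k *s w k) = (\<Sum>k\<in>{i, j}. ?c k *s w k)"
      using I ij by (intro sum.mono_neutral_right) auto
    also have "\<dots> = 0" using ij by simp
    finally have "\<forall>k\<in>I. ?c k = 0"
      using w[unfolded independent_family_def, THEN spec[of _ ?c]] by blast
    then show False using ij(1) by auto
  qed
  show ind: "vec.independent (w ` I)"
  proof
    assume "vec.dependent (w ` I)"
    then obtain u i where u: "(\<Sum>v\<in>w ` I. u v *s v) = 0" "i \<in> I" "u (w i) \<noteq> 0"
      using vec.dependent_finite[of "w ` I"] I by auto
    then have "(\<Sum>i\<in>I. u (w i) *s w i) = 0" using inj by (simp add: sum.reindex)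
    then show False
      using w[unfolded independent_family_def, THEN spec[of _ "\<lambda>i. u (w i)"]] u by blast
  qed
  show "vec.dim (vec.span (w ` I)) = card I"
    using ind inj by (simp add: vec.dim_eq_card_independent card_image)
qed

lemma op_spectrum_iff:
  fixes f :: "complex^'m \<Rightarrow> complex^'m"
  assumes f: "Vector_Spaces.linear (*s) (*s) f"
  shows "z \<in> op_spectrum f \<longleftrightarrow> (\<exists>v. v \<noteq> 0 \<and> f v = z *s v)"
proof -
  interpret f: Vector_Spaces.linear "(*s)" "(*s)" f by (rule f)
  let ?g = "\<lambda>v. f v - z *s v"
  have g: "Vector_Spaces.linear (*s) (*s) ?g"
    by unfold_locales (simp_all add: f.add f.scale vec.scale_right_diff_distrib vec.scale_right_distrib mult.commute)
  interpret g: Vector_Spaces.linear "(*s)" "(*s)" ?g by (rule g)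
  have "bij ?g \<longleftrightarrow> inj ?g"
    using vec.linear_injective_imp_surjective[OF g] by (auto simp: bij_def)
  also have "\<dots> \<longleftrightarrow> (\<forall>v. f v - z *s v = 0 \<longrightarrow> v = 0)"
    by (rule g.inj_iff_eq_0)
  finally show ?thesis by (auto simp: op_spectrum_def)
qed

lemma eigenbasis:
  fixes f :: "complex^'m \<Rightarrow> complex^'m"
  assumes f: "Vector_Spaces.linear (*s) (*s) f" and I: "finite I" "card I = CARD('m)"
    and w: "independent_family I w" and ev: "\<And>i. i \<in> I \<Longrightarrow> f (w i) = \<nu> i *s w i"
  shows "op_spectrum f = \<nu> ` I" and "eigen_mult f z = card {i \<in> I. \<nu> i = z}"
proof -
  interpret f: Vector_Spaces.linear "(*s)" "(*s)" f by (rule f)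
  note ind = independent_family_imp[OF I(1) w]
  have full: "UNIV \<subseteq> vec.span (w ` I)"
    using ind I by (intro vec.card_ge_dim_independent) (simp_all add: card_image card_cart_basis)
  have sp: "\<exists>c. v = (\<Sum>i\<in>I. c i *s w i)" for v
  proof -
    have "v \<in> range (\<lambda>u. \<Sum>a\<in>w ` I. u a *s a)" using full I by (auto simp: vec.span_finite)
    then show ?thesis using ind by (auto simp: sum.reindex o_def)
  qed
  have space: "{v. f v = z *s v} = vec.span (w ` {i \<in> I. \<nu> i = z})" for z
  proof
    show "vec.span (w ` {i \<in> I. \<nu> i = z}) \<subseteq> {v. f v = z *s v}"
      by (rule vec.span_minimal)
        (auto simp: ev vec.subspace_def f.add f.scale f.zero vec.scale_right_distrib mult.commute)
    show "{v. f v = z *s v} \<subseteq> vec.span (w ` {i \<in> I. \<nu> i = z})"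
    proof
      fix v assume "v \<in> {v. f v = z *s v}"
      then have v: "f v = z *s v" by simp
      obtain c where c: "v = (\<Sum>i\<in>I. c i *s w i)" using sp by blast
      have "f v = (\<Sum>i\<in>I. (c i * \<nu> i) *s w i)"
        by (simp add: c f.sum f.scale ev)
      moreover have "z *s v = (\<Sum>i\<in>I. (c i * z) *s w i)"
        by (simp add: c vec.scale_sum_right mult.commute)
      ultimately have "(\<Sum>i\<in>I. (c i * (\<nu> i - z)) *s w i) = 0"
        using v by (simp add: right_diff_distrib vec.scale_left_diff_distrib sum_subtractf)
      then have "\<forall>i\<in>I. c i * (\<nu> i - z) = 0"
        using w[unfolded independent_family_def, THEN spec[of _ "\<lambda>i. c i * (\<nu> i - z)"]] by blast
      then have "v = (\<Sum>i\<in>{i \<in> I. \<nu> i = z}. c i *s w i)"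
        unfolding c using I by (intro sum.mono_neutral_right) auto
      then show "v \<in> vec.span (w ` {i \<in> I. \<nu> i = z})"
        by (simp only:) (rule vec.span_sum, rule vec.span_scale, rule vec.span_base, blast)
    qed
  qed
  have sub: "independent_family J w" if "J \<subseteq> I" for J
    unfolding independent_family_def
  proof (intro allI impI)
    fix c assume "(\<Sum>i\<in>J. c i *s w i) = 0"
    then have "(\<Sum>i\<in>I. (if i \<in> J then c i else 0) *s w i) = 0"
      using that I by (subst sum.mono_neutral_cong_right[of I J _ "\<lambda>i. c i *s w i"]) auto
    then have "\<forall>i\<in>I. (if i \<in> J then c i else 0) = 0"
      using w[unfolded independent_family_def, THEN spec[of _ "\<lambda>i. if i \<in> J then c i else 0"]] by blast
    then show "\<forall>i\<in>J. c i = 0" using that by (metis subsetD)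
  qed
  show em: "eigen_mult f z = card {i \<in> I. \<nu> i = z}" for z
    unfolding eigen_mult_def space using I by (intro independent_family_imp sub) auto
  have nz: "w i \<noteq> 0" if "i \<in> I" for i
    using ind(2) that vec.dependent_zero by (metis imageI)
  show "op_spectrum f = \<nu> ` I"
  proof (intro equalityI subsetI)
    fix z assume "z \<in> op_spectrum f"
    then obtain v where "v \<noteq> 0" "f v = z *s v" using op_spectrum_iff[OF f] by blast
    then have "v \<in> vec.span (w ` {i \<in> I. \<nu> i = z})" using space by blast
    with \<open>v \<noteq> 0\<close> have "{i \<in> I. \<nu> i = z} \<noteq> {}"
      by (metis image_empty singletonD vec.span_empty)
    then show "z \<in> \<nu> ` I" by blast
  next
    fix z assume "z \<in> \<nu> ` I"
    then show "z \<in> op_spectrum f" using ev nz unfolding op_spectrum_iff[OF f] by blast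
  qed
qed

lemma finite_eigenvalues:
  fixes f :: "complex^'m \<Rightarrow> complex^'m"
  assumes f: "Vector_Spaces.linear (*s) (*s) f"
  shows "finite {z. \<exists>v. v \<noteq> 0 \<and> f v = z *s v}"
proof (rule ccontr)
  assume "infinite {z. \<exists>v. v \<noteq> 0 \<and> f v = z *s v}"
  then obtain Z where Z: "finite Z" "card Z = Suc (CARD('m))" "Z \<subseteq> {z. \<exists>v. v \<noteq> 0 \<and> f v = z *s v}"
    using infinite_arbitrarily_large by blast
  then have "\<forall>z\<in>Z. \<exists>v. v \<noteq> 0 \<and> f v = z *s v" by blast
  from bchoice[OF this] obtain w where w: "\<forall>z\<in>Z. w z \<noteq> 0 \<and> f (w z) = z *s w z" ..
  have "independent_family Z w"
    unfolding independent_family_def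
    using vec.eigenvectors_independent[OF f Z(1), of id w] w by auto
  then have "vec.dim (vec.span (w ` Z)) = Suc (CARD('m))"
    using independent_family_imp Z by metis
  then show False using dim_subset_UNIV_cart_gen[of "vec.span (w ` Z)"] by simp
qed

section \<open>The infinitesimal representation and its dimension\<close>

text \<open>Commutation with a fixed matrix is a linear operator on the space of matrices, and highest
  weight theory will be applied there as well.\<close>

interpretation mat: vector_space "mscale :: complex \<Rightarrow> complex^'n^'m \<Rightarrow> complex^'n^'m"
  by unfold_locales (simp_all add: mscale_def vec_eq_iff algebra_simps)

lemma mscale_mult: "mscale c X ** Y = mscale c (X ** Y)" "X ** mscale c Y = mscale c (X ** Y)"
  and mscale_mult_vec: "mscale c X *v v = c *s (X *v v)"
  by (simp_all add: mscale_def matrix_matrix_mult_def matrix_vector_mult_def vec_eq_iff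
      sum_distrib_left mult_ac)

lemma commutator_bilinear:
  "commutator (X + Y) Z = commutator X Z + commutator Y Z"
  "commutator (X - Y) Z = commutator X Z - commutator Y Z"
  "commutator X (Y - Z) = commutator X Y - commutator X Z"
  "commutator (mscale c X) Z = mscale c (commutator X Z)"
  "commutator (- X) Z = - commutator X Z"
  by (simp_all add: commutator_def mm.minus_left mm.minus_right mm.add_left mm.add_right mm.diff_left mm.diff_right mscale_mult
      mat.scale_right_diff_distrib)

lemma commutator_swap: "commutator X Y = - commutator Y X" and commutator_self: "commutator X X = 0"
  by (simp_all add: commutator_def)

lemma commutator_jacobi:
  "commutator X (commutator Y Z) = commutator Y (commutator X Z) + commutator (commutator X Y) Z"
  by (simp add: commutator_def mm.diff_left mm.diff_right matrix_mul_assoc)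

lemma commutator_mult: "commutator X (Y ** Z) = commutator X Y ** Z + Y ** commutator X Z"
  by (simp add: commutator_def mm.diff_left mm.diff_right matrix_mul_assoc)

lemma linear_commutator: "Vector_Spaces.linear mscale mscale (commutator X)"
  by unfold_locales (simp_all add: commutator_add commutator_mscale)

text \<open>Three matrices acting in two ways, on column vectors (\<open>std\<close>) and on matrices by
  commutators (\<open>ad\<close>).\<close>

locale sl2_matrices =
  fixes e f h :: "complex^'d^'d"
  assumes he: "commutator h e = mscale 2 e" and hf: "commutator h f = mscale (- 2) f"
    and ef: "commutator e f = h"
begin

sublocale std: sl2_triple "(*s)" "(*v) e" "(*v) f" "(*v) h"
proof
  fix v :: "complex^'d"
  have c: "X *v (Y *v v) = Y *v (X *v v) + commutator X Y *v v" for X Y :: "complex^'d^'d"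
    by (simp add: commutator_def matrix_vector_mul_assoc matrix_vector_mult_diff_rdistrib)
  show "h *v (e *v v) = e *v (h *v v) + 2 *s (e *v v)"
    "h *v (f *v v) = f *v (h *v v) - 2 *s (f *v v)"
    "e *v (f *v v) = f *v (e *v v) + h *v v"
    using c[of h e] c[of h f] c[of e f] by (simp_all add: he hf ef mscale_mult_vec mv.minus_left)
qed

sublocale ad: sl2_triple mscale "commutator e" "commutator f" "commutator h"
proof (intro sl2_triple.intro mat.vector_space_axioms sl2_triple_axioms.intro linear_commutator)
  fix T :: "complex^'d^'d"
  show "commutator h (commutator e T) = commutator e (commutator h T) + mscale 2 (commutator e T)"
    "commutator h (commutator f T) = commutator f (commutator h T) - mscale 2 (commutator f T)"
    "commutator e (commutator f T) = commutator f (commutator e T) + commutator h T"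
    using commutator_jacobi[of h e T] commutator_jacobi[of h f T] commutator_jacobi[of e f T]
    by (simp_all add: he hf ef commutator_bilinear)
qed

definition e_pow :: "nat \<Rightarrow> complex^'d^'d" where
  "e_pow l = ((**) e ^^ l) (mat 1)"

lemma e_pow_0: "e_pow 0 = mat 1" and e_pow_Suc: "e_pow (Suc l) = e ** e_pow l"
  by (simp_all add: e_pow_def)

lemma ad_e_e_pow: "commutator e (e_pow l) = 0"
  by (induction l) (simp_all add: e_pow_0 e_pow_Suc commutator_mult commutator_self,
    simp add: commutator_def)

lemma ad_h_e_pow: "commutator h (e_pow l) = mscale (of_nat (2 * l)) (e_pow l)"
proof (induction l)
  case (Suc l)
  then show ?case
    by (simp add: e_pow_Suc commutator_mult he mscale_mult flip: mat.scale_left_distrib)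
qed (simp add: e_pow_0 commutator_def)

text \<open>The power \<open>e\<^sup>l\<close> takes the \<open>l\<close>-th string vector back to a nonzero multiple of the highest
  weight vector.\<close>

lemma e_pow_nonzero:
  assumes v: "e *v v = 0" "h *v v = of_nat n *s v" "v \<noteq> 0" and "l \<le> n"
  shows "e_pow l \<noteq> 0"
proof -
  have "e_pow l *v std.string v l \<noteq> 0"
    using \<open>l \<le> n\<close>
  proof (induction l)
    case (Suc l)
    have "e_pow (Suc l) = e_pow l ** e"
      using ad_e_e_pow[of l] by (simp add: e_pow_Suc commutator_def)
    then have "e_pow (Suc l) *v std.string v (Suc l) = e_pow l *v (e *v std.string v (Suc l))"
      by (simp add: matrix_vector_mul_assoc)
    also have "\<dots> = ((of_nat l + 1) * (of_nat n - of_nat l)) *s (e_pow l *v std.string v l)"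
      by (simp add: std.e_string[OF v] vector_scalar_commute)
    finally have eq: "e_pow (Suc l) *v std.string v (Suc l) =
        ((of_nat l + 1) * (of_nat n - of_nat l)) *s (e_pow l *v std.string v l)" .
    moreover have "of_nat l + 1 \<noteq> (0::complex)"
      using of_nat_neq_0[of l, where 'a = complex] by (simp add: add.commute)
    moreover have "of_nat n - of_nat l \<noteq> (0::complex)"
      using Suc.prems by simp
    ultimately show ?case using Suc by simp
  qed (simp add: e_pow_0 std.string_0 v)
  then show ?thesis by auto
qed

end

context su2_rep
begin

definition e :: "complex^'d^'d" where "e = mscale (1/2) (mscale \<i> (A 1) + A 2)"
definition f :: "complex^'d^'d" where "f = mscale (1/2) (mscale \<i> (A 1) - A 2)"
definition h :: "complex^'d^'d" where "h = mscale (- \<i>) (A 3)"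

lemma A_eq: "A 1 = mscale (- \<i>) (e + f)" "A 2 = e - f" "A 3 = mscale \<i> h"
  by (simp_all add: e_def f_def h_def mscale_def vec_eq_iff algebra_simps)

sublocale sl2: sl2_matrices e f h
proof
  have s: "2 *\<^sub>R X = mscale 2 X" for X :: "complex^'d^'d"
    using mscale_of_real[of 2 X] by simp
  note c = A_commutators[unfolded s]
  have c': "commutator (A 2) (A 1) = - mscale 2 (A 3)" "commutator (A 3) (A 2) = - mscale 2 (A 1)"
    using c by (subst commutator_swap, simp)+
  show "commutator h e = mscale 2 e" "commutator h f = mscale (- 2) f" "commutator e f = h"
    unfolding e_def f_def h_def
    by (simp_all only: commutator_bilinear commutator_add commutator_mscale c c' commutator_self)
      (simp_all add: mscale_def vec_eq_iff algebra_simps)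
qed

end

locale su2_irrep = su2_rep U for U :: "complex^2^2 \<Rightarrow> complex^'d^'d" +
  fixes n :: nat
  assumes irreducible: "irreducible_rep U" and highest_weight: "highest_weight U n"
begin

text \<open>The vector \<open>e *v v\<close> would have weight \<open>n + 2\<close>, which exceeds the highest weight.\<close>

lemma highest_weight_vector: "\<exists>v. v \<noteq> 0 \<and> e *v v = 0 \<and> h *v v = of_nat n *s v"
proof -
  have wt: "is_weight U \<mu>" if "v \<noteq> 0" "h *v v = of_real \<mu> *s v" for \<mu> v
    using that unfolding is_weight_def A_eq(3) mscale_mult_vec by (auto intro!: exI[of _ v])
  obtain v where v: "v \<noteq> 0" "A 3 *v v = (\<i> * of_real (real n)) *s v"
    using highest_weight unfolding highest_weight_def is_weight_def by blast
  have hv: "h *v v = of_nat n *s v" unfolding h_def mscale_mult_vec v(2) by simp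
  have "h *v (e *v v) = of_real (real (n + 2)) *s (e *v v)"
    using sl2.std.he[of v] by (simp add: hv vector_scalar_commute vec.scale_left_distrib add.commute)
  then have "is_weight U (real (n + 2))" if "e *v v \<noteq> 0" using wt that by blast
  then have "e *v v = 0"
    using highest_weight unfolding highest_weight_def by fastforce
  with v hv show ?thesis by blast
qed

text \<open>The string of a highest weight vector spans a subspace \<open>W\<close> invariant under \<open>A 1, A 2, A 3\<close>, hence
  under \<open>SU(2)\<close>.  By irreducibility \<open>W\<close> is everything, and the \<open>n + 1\<close> string vectors up to
  index \<open>n\<close> are independent, having distinct weights.\<close>

lemma dimension: "CARD('d) = n + 1"
proof -
  obtain v where v: "e *v v = 0" "h *v v = of_nat n *s v" "v \<noteq> 0"
    using highest_weight_vector by blast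
  let ?s = "sl2.std.string v"
  have lin: "Vector_Spaces.linear (*s) (*s) ((*v) h)" by (rule sl2.std.lin)
  have end0: "?s (Suc n) = 0"
    by (rule sl2.std.string_end[OF v finite_eigenvalues[OF lin]])
  define W where "W = vec.span (?s ` {..n})"
  have W: "vec.subspace W" by (simp add: W_def)
  have sW: "c *s ?s k \<in> W" if "k \<le> Suc n" for c k
  proof (cases "k = Suc n")
    case True
    then show ?thesis using end0 W by (simp add: vec.subspace_0)
  next
    case False
    then have "?s k \<in> ?s ` {..n}" using that by auto
    then show ?thesis unfolding W_def by (intro vec.span_scale vec.span_base)
  qed
  have gen: "X *v w \<in> W" if "w \<in> W" and X: "\<And>k. k \<le> n \<Longrightarrow> X *v ?s k \<in> W" for X w
    using that(1) unfolding W_def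
  proof (induction rule: vec.span_induct_alt)
    case base
    then show ?case by (simp add: vec.span_zero)
  next
    case (step c x y)
    then show ?case using X unfolding W_def
      by (auto simp: matrix_vector_right_distrib vector_scalar_commute
          intro!: vec.span_add[OF vec.span_scale])
  qed
  have f: "f *v w \<in> W" if "w \<in> W" for w
    by (rule gen[OF that]) (use sW[of _ 1] in \<open>simp flip: sl2.std.string_Suc\<close>)
  have h: "h *v w \<in> W" if "w \<in> W" for w
    by (rule gen[OF that], unfold sl2.std.h_string[OF v], rule sW, simp)
  have e: "e *v w \<in> W" if "w \<in> W" for w
  proof (rule gen[OF that])
    fix k assume "k \<le> n"
    then show "e *v ?s k \<in> W"
    proof (cases k)
      case 0
      then show ?thesis using W by (simp add: sl2.std.string_0 v vec.subspace_0)
    next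
      case (Suc i)
      then show ?thesis using \<open>k \<le> n\<close> unfolding Suc sl2.std.e_string[OF v] by (intro sW) simp
    qed
  qed
  have "A j *v w \<in> W" if "j \<in> {1..3}" "w \<in> W" for j w
  proof -
    have "j = 1 \<or> j = 2 \<or> j = 3" using that by auto
    then show ?thesis
      using W e[OF that(2)] f[OF that(2)] h[OF that(2)]
      by (elim disjE) (simp_all only: A_eq mscale_mult_vec matrix_vector_mult_add_rdistrib
          matrix_vector_mult_diff_rdistrib vec.subspace_add vec.subspace_diff vec.subspace_scale)
  qed
  then have "W = {0} \<or> W = UNIV"
    using irreducible W invariant_subspace unfolding irreducible_rep_def by blast
  moreover have "v \<in> W" using sW[of 0 1] by (simp add: sl2.std.string_0)
  ultimately have "W = UNIV" using v by blast
  moreover have "vec.dim W = card {..n}"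
    unfolding W_def
  proof (rule independent_family_imp)
    have "inj_on (\<lambda>k. of_nat n - 2 * of_nat k :: complex) {..n}" by (auto simp: inj_on_def)
    then show "independent_family {..n} ?s"
      unfolding independent_family_def
      using vec.eigenvectors_independent[OF lin, of "{..n}" "\<lambda>k. of_nat n - 2 * of_nat k" ?s]
        sl2.std.h_string[OF v] sl2.std.string_nonzero[OF v] by auto
  qed simp
  ultimately show ?thesis using vec_dim_card[where 'a = complex and 'n = 'd] by simp
qed

lemma e_pow_nonzero: "l \<le> n \<Longrightarrow> sl2.e_pow l \<noteq> 0"
  using highest_weight_vector sl2.e_pow_nonzero by blast

end

lemma SU2_irrep_iff: "SU2_irrep U n \<longleftrightarrow> su2_irrep U n"
  by (simp add: SU2_irrep_def su2_irrep_def su2_irrep_axioms_def su2_rep_def)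

section \<open>The spinor representation\<close>

text \<open>\<open>u\<close> and \<open>d\<close> are eigenvectors of \<open>\<i> \<epsilon>\<^sub>3\<close> for \<open>1\<close> and \<open>-1\<close>.  The relations are those of
  \<open>\<epsilon>\<^sub>j \<mapsto> -E\<^sub>j\<close>, the sign being forced by \<open>\<epsilon>\<^sub>1 \<epsilon>\<^sub>2 \<epsilon>\<^sub>3 = 1\<close>.\<close>

definition spinor_pair :: "(clifford \<Rightarrow> complex^'s^'s) \<Rightarrow> complex^'s \<Rightarrow> complex^'s \<Rightarrow> bool" where
  "spinor_pair \<kappa> u d \<longleftrightarrow> u \<noteq> 0 \<and>
     \<kappa> (cl_gen 1) *v u = \<i> *s d \<and> \<kappa> (cl_gen 2) *v u = d \<and> \<kappa> (cl_gen 3) *v u = - \<i> *s u \<and>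
     \<kappa> (cl_gen 1) *v d = \<i> *s u \<and> \<kappa> (cl_gen 2) *v d = - u \<and> \<kappa> (cl_gen 3) *v d = \<i> *s d"

text \<open>From \<open>\<epsilon>\<^sub>1 \<epsilon>\<^sub>2 \<epsilon>\<^sub>3 = 1\<close> follows \<open>\<epsilon>\<^sub>1 \<epsilon>\<^sub>2 = -\<epsilon>\<^sub>3\<close>, so the action of \<open>\<epsilon>\<^sub>1\<close> is determined by those of
  \<open>\<epsilon>\<^sub>2\<close> and \<open>\<epsilon>\<^sub>3\<close>: any eigenvector \<open>u\<close> of \<open>\<epsilon>\<^sub>3\<close> for \<open>-\<i>\<close>, together with \<open>d = \<epsilon>\<^sub>2 u\<close>, will do.\<close>

lemma spinor_pair_exists:
  fixes \<kappa> :: "clifford \<Rightarrow> complex^'s^'s"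
  assumes rep: "clifford_rep \<kappa>" and gamma: "\<kappa> cl_gamma = mat 1"
  shows "\<exists>u d. spinor_pair \<kappa> u d"
proof -
  note One_nat_def [simp del]
  define K where "K j = \<kappa> (cl_gen j)" for j
  have scale: "\<kappa> (c *s x) = mscale c (\<kappa> x)" and mult: "\<kappa> (x \<odot> y) = \<kappa> x ** \<kappa> y"
    and add: "\<kappa> (x + y) = \<kappa> x + \<kappa> y" and one: "\<kappa> cl_one = mat 1" for c x y
    using rep by (auto simp: clifford_rep_def)
  have ac: "K i ** K j + K j ** K i = mscale (if i = j then - 2 else 0) (mat 1)"
    if "i \<in> {1..3}" "j \<in> {1..3}" for i j
    using cl_gen_anticommute[OF that] unfolding K_def by (metis scale mult add one)
  have sq: "K j ** K j = - mat 1" if "j \<in> {1..3}" for j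
    using ac[OF that that] by (simp add: mscale_def vec_eq_iff)
  have anti: "K j ** K i = - (K i ** K j)" if "i \<in> {1..3}" "j \<in> {1..3}" "i \<noteq> j" for i j
    using ac[OF that(1,2)] that(3) by (simp add: eq_neg_iff_add_eq_0 add.commute)
  have "K 1 ** K 2 ** K 3 = mat 1"
    using gamma by (simp add: K_def cl_gamma_def mult)
  then have "K 1 ** K 2 ** (K 3 ** K 3) = K 3" by (simp add: matrix_mul_assoc)
  then have K12: "K 1 ** K 2 = - K 3" by (simp add: sq mm.minus_right neg_equal_iff_equal[of _ "K 3", symmetric])
  have "K 1 ** (K 2 ** K 2) = - K 3 ** K 2" by (simp add: matrix_mul_assoc K12)
  then have K1: "K 1 = K 3 ** K 2" by (simp add: sq mm.minus_right mm.minus_left)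
  \<comment> \<open>\<open>Q\<close> is twice the projection onto the eigenspace of \<open>\<i> K 3\<close> for \<open>1\<close>.  It is not zero, because
    otherwise \<open>K 1\<close>, which is invertible, would both commute and anticommute with \<open>K 3\<close>.\<close>
  define Q where "Q = mat 1 + mscale \<i> (K 3)"
  have "Q \<noteq> 0"
  proof
    assume "Q = 0"
    then have "K 1 ** Q = 0" "Q ** K 1 = 0" by auto
    then have "K 1 + mscale \<i> (K 1 ** K 3) = 0" "K 1 + mscale \<i> (K 3 ** K 1) = 0"
      by (simp_all add: Q_def mm.add_left mm.add_right mscale_mult)
    moreover have "K 3 ** K 1 = - (K 1 ** K 3)" by (rule anti) auto
    ultimately have "K 1 + K 1 = 0" by (simp add: add_eq_0_iff)
    then have "K 1 = 0" by (simp add: vec_eq_iff)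
    then have "mat 1 = (0 :: complex^'s^'s)" using sq[of 1] by simp
    from arg_cong[OF this, of "\<lambda>M. M $ undefined $ undefined"] show False by (simp add: mat_def)
  qed
  then obtain x where x: "Q *v x \<noteq> 0"
    by (metis matrix_eq matrix_vector_mult_0)
  define u where "u = Q *v x"
  define d where "d = K 2 *v u"
  have "K 3 ** Q = mscale (- \<i>) Q"
    by (simp add: Q_def mm.add_right mscale_mult sq) (simp add: mscale_def vec_eq_iff mat_def algebra_simps)
  then have u3: "K 3 *v u = - \<i> *s u"
    by (simp add: u_def matrix_vector_mul_assoc mscale_mult_vec mv.minus_left)
  have d1: "K 1 *v d = \<i> *s u"
    unfolding d_def matrix_vector_mul_assoc K12 using u3 by (simp add: mv.minus_left)
  have d2: "K 2 *v d = - u"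
    by (simp add: d_def matrix_vector_mul_assoc sq mv.minus_left)
  have "K 3 *v d = - (K 2 *v (K 3 *v u))"
    unfolding d_def matrix_vector_mul_assoc using anti[of 2 3] by (simp add: mv.minus_left)
  then have d3: "K 3 *v d = \<i> *s d"
    by (simp add: u3 d_def vector_scalar_commute mv.minus_right)
  have "K 1 *v u = K 3 *v d" by (simp add: K1 d_def matrix_vector_mul_assoc)
  then show ?thesis
    unfolding spinor_pair_def using x u3 d1 d2 d3 by (auto simp: u_def[symmetric] K_def d_def)
qed

section \<open>Eigenvectors of the Dirac operator\<close>

text \<open>The operator \<open>T \<otimes> \<psi> \<mapsto> [h,T] \<otimes> \<psi> + T \<otimes> S \<psi>\<close>, see \<open>weight_op_tensor\<close>.  With \<open>S = \<i> \<kappa> \<epsilon>\<^sub>3\<close> it is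
  the weight operator of \<open>SU(2)\<close> acting diagonally on \<open>\<B>\<^sup>n \<otimes> \<S>\<close>; here it only has to separate
  the eigenvectors of the Dirac operator.\<close>

definition weight_op :: "complex^'d^'d \<Rightarrow> complex^'s^'s
    \<Rightarrow> complex^(('d \<times> 'd) \<times> 's) \<Rightarrow> complex^(('d \<times> 'd) \<times> 's)" where
  "weight_op h S X = (\<chi> p. commutator h (slice X (snd p)) $ fst (fst p) $ snd (fst p)
      + (\<Sum>b\<in>UNIV. S $ snd p $ b * X $ (fst p, b)))"

lemma slice_add: "slice (X + Y) b = slice X b + slice Y b"
  and slice_scale: "slice (c *s X) b = mscale c (slice X b)"
  and slice_tensor: "slice (tensor T \<psi>) b = mscale (\<psi> $ b) T"
  by (simp_all add: slice_def mscale_def tensor_def vec_eq_iff)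

lemma linear_weight_op: "Vector_Spaces.linear (*s) (*s) (weight_op h S)"
proof -
  have "weight_op h S (X + Y) = weight_op h S X + weight_op h S Y"
    "weight_op h S (c *s X) = c *s weight_op h S X" for X Y c
    by (simp_all add: weight_op_def slice_add slice_scale commutator_add commutator_mscale vec_eq_iff
        sum.distrib algebra_simps sum_distrib_left mscale_nth)
  then show ?thesis
    by unfold_locales (simp_all add: vec.scale_right_distrib vec.scale_left_distrib)
qed

lemma weight_op_tensor:
  "weight_op h S (tensor T \<psi>) = tensor (commutator h T) \<psi> + tensor T (S *v \<psi>)"
  unfolding weight_op_def slice_tensor commutator_mscale
  by (simp add: tensor_def vec_eq_iff mscale_nth matrix_vector_mult_def sum_distrib_left mult_ac)

locale su2_dirac = su2_irrep U n for U :: "complex^2^2 \<Rightarrow> complex^'d^'d" and n +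
  fixes \<kappa> :: "clifford \<Rightarrow> complex^'s^'s" and up down :: "complex^'s"
  assumes spinors: "spinor_pair \<kappa> up down"
begin

abbreviation dirac_op ("\<DD>") where "\<DD> \<equiv> dirac U \<kappa>"

abbreviation weight ("\<W>") where "\<W> \<equiv> weight_op h (mscale \<i> (\<kappa> (cl_gen 3)))"

lemma dirac_up: "\<DD> (tensor T up) = 2 *s tensor (commutator e T) down + tensor (commutator h T) up"
  and dirac_down: "\<DD> (tensor T down) = 2 *s tensor (commutator f T) up - tensor (commutator h T) down"
proof -
  have s: "(\<Sum>j=1..3. F j) = F 1 + F 2 + F 3" for F :: "nat \<Rightarrow> complex^(('d \<times> 'd) \<times> 's)"
  proof -
    have "{1..3::nat} = {1, 2, 3}" by auto
    then show ?thesis by simp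
  qed
  note sp = spinors[unfolded spinor_pair_def]
  show "\<DD> (tensor T up) = 2 *s tensor (commutator e T) down + tensor (commutator h T) up"
    unfolding dirac_tensor s A_eq commutator_bilinear
    by (simp only: sp) (simp add: vec_eq_iff tensor_def mscale_nth algebra_simps)
  show "\<DD> (tensor T down) = 2 *s tensor (commutator f T) up - tensor (commutator h T) down"
    unfolding dirac_tensor s A_eq commutator_bilinear
    by (simp only: sp) (simp add: vec_eq_iff tensor_def mscale_nth algebra_simps)
qed

lemma weight_up: "\<W> (tensor T up) = tensor (commutator h T) up + tensor T up"
  and weight_down: "\<W> (tensor T down) = tensor (commutator h T) down - tensor T down"
proof -
  note sp = spinors[unfolded spinor_pair_def]
  show "\<W> (tensor T up) = tensor (commutator h T) up + tensor T up"
    "\<W> (tensor T down) = tensor (commutator h T) down - tensor T down"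
    unfolding weight_op_tensor mscale_mult_vec
    by (simp_all only: sp) (simp_all add: vec_eq_iff tensor_def)
qed

text \<open>Entrywise, \<open>s up + t down = 0\<close> forces \<open>s = t = 0\<close>, as \<open>up\<close> and \<open>down\<close> belong to different
  eigenvalues of \<open>\<epsilon>\<^sub>3\<close>.\<close>

lemma tensor_up_down_eq_0:
  assumes eq: "tensor S up + tensor T down = 0" shows "S = 0" and "T = 0"
proof -
  note sp = spinors[unfolded spinor_pair_def]
  have "S $ i $ j = 0 \<and> T $ i $ j = 0" for i j
  proof -
    let ?x = "S $ i $ j *s up" and ?y = "T $ i $ j *s down"
    have xy: "?x + ?y = 0"
      using eq by (simp add: tensor_def vec_eq_iff)
    then have "\<kappa> (cl_gen 3) *v (?x + ?y) = 0" by simp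
    then have "- \<i> *s ?x + \<i> *s ?y = 0"
      using sp by (simp add: matrix_vector_right_distrib vector_scalar_commute mult.commute)
    then have "\<i> *s (?y - ?x) = 0"
      by (simp add: vec.scale_right_diff_distrib mult.commute)
    then have "?y = ?x" by (metis complex_i_not_zero eq_iff_diff_eq_0 vec.scale_eq_0_iff)
    then have "2 *s ?x = 0" "2 *s ?y = 0" using xy by (metis vec.scale_left_distrib vec.scale_one one_add_one)+
    moreover have "down \<noteq> 0" using sp by force
    ultimately show ?thesis using sp by simp
  qed
  then show "S = 0" "T = 0" by (simp_all add: vec_eq_iff)
qed

text \<open>The string of \<open>e\<^sup>l\<close> under commutation with \<open>f\<close>, of weights \<open>2l, 2l - 2, \<dots>\<close>.\<close>

definition ladder :: "nat \<Rightarrow> nat \<Rightarrow> complex^'d^'d" where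
  "ladder l k = sl2.ad.string (sl2.e_pow l) k"

context
  fixes l :: nat assumes l: "l \<le> n"
begin

lemmas hw = sl2.ad_e_e_pow[of l] sl2.ad_h_e_pow[of l] e_pow_nonzero[OF l]

lemma ad_e_0: "commutator e (ladder l 0) = 0"
  by (simp add: ladder_def sl2.ad.string_0 hw)

lemma ad_e_Suc: "commutator e (ladder l (Suc k)) = mscale ((of_nat k + 1) * (2 * of_nat l - of_nat k)) (ladder l k)"
  using sl2.ad.e_string[OF hw, of k] by (simp add: ladder_def)

lemma ad_f: "commutator f (ladder l k) = ladder l (Suc k)"
  by (simp add: ladder_def sl2.ad.string_Suc)

lemma ad_h: "commutator h (ladder l k) = mscale (2 * of_nat l - 2 * of_nat k) (ladder l k)"
  using sl2.ad.h_string[OF hw, of k] by (simp add: ladder_def)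

lemma ladder_nonzero: "k \<le> 2 * l \<Longrightarrow> ladder l k \<noteq> 0"
  unfolding ladder_def by (rule sl2.ad.string_nonzero[OF hw])

lemma dirac_ladder:
  "\<DD> (tensor (ladder l 0) up) = (2 * of_nat l) *s tensor (ladder l 0) up"
  "\<DD> (tensor (ladder l (Suc k)) up) = (2 * (of_nat k + 1) * (2 * of_nat l - of_nat k)) *s tensor (ladder l k) down
      + (2 * of_nat l - 2 * of_nat k - 2) *s tensor (ladder l (Suc k)) up"
  "\<DD> (tensor (ladder l k) down) = 2 *s tensor (ladder l (Suc k)) up - (2 * of_nat l - 2 * of_nat k) *s tensor (ladder l k) down"
  unfolding dirac_up dirac_down ad_e_0 ad_e_Suc ad_f ad_h tensor_mscale
  by (simp_all add: vec_eq_iff tensor_def algebra_simps)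

lemma weight_ladder:
  "\<W> (tensor (ladder l k) up) = (2 * of_nat l - 2 * of_nat k + 1) *s tensor (ladder l k) up"
  "\<W> (tensor (ladder l k) down) = (2 * of_nat l - 2 * of_nat k - 1) *s tensor (ladder l k) down"
  unfolding weight_up weight_down ad_h tensor_mscale
  by (simp_all add: vec_eq_iff algebra_simps)

text \<open>Each pair \<open>ladder l (k + 1) \<otimes> up\<close>, \<open>ladder l k \<otimes> down\<close> spans a space on which the Dirac operator acts
  by a \<open>2 \<times> 2\<close> matrix of trace \<open>-2\<close> and determinant \<open>-4 l (l + 1)\<close>; \<open>pos\<close> and \<open>neg\<close> are its eigenvectors
  for \<open>2l\<close> and \<open>-2l - 2\<close>.  For \<open>k = 0\<close> the truncated difference \<open>k - 1\<close> in \<open>pos\<close> is multiplied by \<open>0\<close>,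
  so that \<open>pos 0\<close> is \<open>ladder l 0 \<otimes> up\<close>.\<close>

definition pos :: "nat \<Rightarrow> complex^(('d \<times> 'd) \<times> 's)" where
  "pos k = tensor (ladder l k) up + of_nat k *s tensor (ladder l (k - 1)) down"

definition neg :: "nat \<Rightarrow> complex^(('d \<times> 'd) \<times> 's)" where
  "neg k = tensor (ladder l (Suc k)) up - (2 * of_nat l - of_nat k) *s tensor (ladder l k) down"

lemma dirac_pos: "\<DD> (pos k) = (2 * of_nat l) *s pos k"
  and weight_pos: "\<W> (pos k) = (2 * of_nat l + 1 - 2 * of_nat k) *s pos k"
  and dirac_neg: "\<DD> (neg k) = (- 2 * of_nat l - 2) *s neg k"
  and weight_neg: "\<W> (neg k) = (2 * of_nat l - 1 - 2 * of_nat k) *s neg k"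
proof -
  interpret D: Vector_Spaces.linear "(*s)" "(*s)" \<DD> by (rule dirac_linear)
  interpret W: Vector_Spaces.linear "(*s)" "(*s)" \<W> by (rule linear_weight_op)
  show "\<DD> (pos k) = (2 * of_nat l) *s pos k"
    by (cases k) (simp_all only: pos_def D.add D.scale dirac_ladder,
        simp_all add: vec_eq_iff algebra_simps)
  show "\<W> (pos k) = (2 * of_nat l + 1 - 2 * of_nat k) *s pos k"
    by (cases k) (simp_all only: pos_def W.add W.scale weight_ladder,
        simp_all add: vec_eq_iff algebra_simps)
  show "\<DD> (neg k) = (- 2 * of_nat l - 2) *s neg k"
    by (simp only: neg_def D.diff D.scale dirac_ladder, simp add: vec_eq_iff algebra_simps)
  show "\<W> (neg k) = (2 * of_nat l - 1 - 2 * of_nat k) *s neg k"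
    by (simp only: neg_def W.diff W.scale weight_ladder, simp add: vec_eq_iff algebra_simps)
qed

text \<open>Up to \<open>k = 2l\<close> the first component is nonzero; for \<open>k = 2l + 1\<close> the second one is, as it
  contains the last nonzero member of the string.\<close>

lemma pos_nonzero: assumes "k \<le> 2 * l + 1" shows "pos k \<noteq> 0"
proof
  assume "pos k = 0"
  then have 0: "tensor (ladder l k) up + tensor (mscale (of_nat k) (ladder l (k - 1))) down = 0"
    by (simp add: pos_def tensor_mscale)
  then have "ladder l k = 0" by (rule tensor_up_down_eq_0)
  then have k: "k = 2 * l + 1" using ladder_nonzero[of k] assms by force
  have "mscale (of_nat k) (ladder l (k - 1)) = 0" using 0 by (rule tensor_up_down_eq_0)
  moreover have "of_nat k \<noteq> (0::complex)" using k by (simp only: of_nat_eq_0_iff)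
  ultimately have "ladder l (k - 1) = 0" using mat.scale_eq_0_iff by blast
  then show False using ladder_nonzero[of "k - 1"] k by simp
qed

lemma neg_nonzero: assumes "k < 2 * l" shows "neg k \<noteq> 0"
proof
  assume "neg k = 0"
  then have "tensor (ladder l (Suc k)) up + tensor (mscale (- (2 * of_nat l - of_nat k)) (ladder l k)) down = 0"
    unfolding neg_def tensor_mscale by (simp only: vec.scale_minus_left diff_conv_add_uminus)
  then have "ladder l (Suc k) = 0" by (rule tensor_up_down_eq_0)
  then show False using ladder_nonzero[of "Suc k"] assms by simp
qed

end

end

section \<open>The spectrum\<close>

text \<open>The eigenvalues of \<open>D'\<close>, as integers, so that the multiplicity of \<open>x\<close> is \<open>\<bar>x\<bar>\<close>.\<close>

definition eigenvalues :: "nat \<Rightarrow> int set" where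
  "eigenvalues n = (\<lambda>k. 2 * int k) ` {1..n + 1} \<union> (\<lambda>k. - 2 * int k) ` {1..n}"

lemma eigenvalues_cases:
  assumes "x \<in> eigenvalues n"
  obtains (pos) l where "l \<le> n" "x = 2 * int l + 2" | (neg) l where "1 \<le> l" "l \<le> n" "x = - 2 * int l"
proof -
  consider k where "k \<in> {1..n + 1}" "x = 2 * int k" | k where "k \<in> {1..n}" "x = - 2 * int k"
    using assms by (auto simp: eigenvalues_def)
  then show thesis
  proof cases
    case (1 k)
    then show thesis by (intro pos[of "k - 1"]) auto
  next
    case (2 k)
    then show thesis by (intro neg[of k]) auto
  qed
qed

lemma sum_eigenvalues: "(\<Sum>x\<in>eigenvalues n. nat \<bar>x\<bar>) = 2 * (n + 1)\<^sup>2"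
proof -
  have "(\<Sum>x\<in>eigenvalues n. nat \<bar>x\<bar>) =
      (\<Sum>x\<in>(\<lambda>k. 2 * int k) ` {1..n + 1}. nat \<bar>x\<bar>) + (\<Sum>x\<in>(\<lambda>k. - 2 * int k) ` {1..n}. nat \<bar>x\<bar>)"
    unfolding eigenvalues_def by (intro sum.union_disjoint) auto
  also have "(\<Sum>x\<in>(\<lambda>k. 2 * int k) ` {1..n + 1}. nat \<bar>x\<bar>) = (\<Sum>k=1..n + 1. 2 * k)"
    by (subst sum.reindex) (simp_all add: inj_on_def nat_mult_distrib o_def del: sum.cl_ivl_Suc)
  also have "(\<Sum>x\<in>(\<lambda>k. - 2 * int k) ` {1..n}. nat \<bar>x\<bar>) = (\<Sum>k=1..n. 2 * k)"
    by (subst sum.reindex) (simp_all add: inj_on_def nat_mult_distrib o_def del: sum.cl_ivl_Suc)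
  also have "(\<Sum>k=1..n + 1. 2 * k) + (\<Sum>k=1..n. 2 * k) = 2 * (n + 1)\<^sup>2"
    by (induction n) (auto simp: power2_eq_square)
  finally show ?thesis .
qed

context su2_dirac
begin

text \<open>The eigenvectors are indexed by an eigenvalue \<open>x\<close> of \<open>D'\<close> and a number \<open>j < \<bar>x\<bar>\<close>.
  The parameter \<open>l\<close> is recovered from \<open>x = 2l + 2\<close> or \<open>x = -2l\<close>, and the weight is \<open>\<bar>x\<bar> - 1 - 2j\<close> in
  both cases.\<close>

definition joint_eigenvector :: "int \<times> nat \<Rightarrow> complex^(('d \<times> 'd) \<times> 's)" where
  "joint_eigenvector = (\<lambda>(x, j). if x > 0 then pos (nat x div 2 - 1) j else neg (nat (- x) div 2) j)"

lemma joint_eigenvector: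
  assumes x: "x \<in> eigenvalues n" and j: "j < nat \<bar>x\<bar>"
  shows "\<DD> (joint_eigenvector (x, j)) + 2 *s joint_eigenvector (x, j) = of_int x *s joint_eigenvector (x, j)"
    and "\<W> (joint_eigenvector (x, j)) = of_int (\<bar>x\<bar> - 1 - 2 * int j) *s joint_eigenvector (x, j)"
    and "joint_eigenvector (x, j) \<noteq> 0"
proof -
  from x have "\<DD> (joint_eigenvector (x, j)) = of_int (x - 2) *s joint_eigenvector (x, j)
      \<and> \<W> (joint_eigenvector (x, j)) = of_int (\<bar>x\<bar> - 1 - 2 * int j) *s joint_eigenvector (x, j) \<and> joint_eigenvector (x, j) \<noteq> 0"
  proof (cases rule: eigenvalues_cases)
    case (pos l)
    then have "joint_eigenvector (x, j) = su2_dirac.pos U up down l j"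
      by (simp add: joint_eigenvector_def nat_add_distrib nat_mult_distrib)
    then show ?thesis
      using pos j dirac_pos[OF pos(1), of j] weight_pos[OF pos(1), of j] pos_nonzero[OF pos(1), of j]
      by (simp add: algebra_simps nat_add_distrib nat_mult_distrib)
  next
    case (neg l)
    then have "joint_eigenvector (x, j) = su2_dirac.neg U up down l j"
      by (simp add: joint_eigenvector_def nat_mult_distrib)
    then show ?thesis
      using neg j dirac_neg[OF neg(2), of j] weight_neg[OF neg(2), of j] neg_nonzero[OF neg(2), of j]
      by (simp add: algebra_simps nat_mult_distrib)
  qed
  then show "\<DD> (joint_eigenvector (x, j)) + 2 *s joint_eigenvector (x, j) = of_int x *s joint_eigenvector (x, j)"
    and "\<W> (joint_eigenvector (x, j)) = of_int (\<bar>x\<bar> - 1 - 2 * int j) *s joint_eigenvector (x, j)"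
    and "joint_eigenvector (x, j) \<noteq> 0"
    by (simp_all add: vec_eq_iff algebra_simps)
qed

text \<open>The eigenvalues \<open>x\<close> and \<open>\<bar>x\<bar> - 1 - 2j\<close> of \<open>D'\<close> and of the weight operator are real, so they can be
  recovered from \<open>x + \<i> (\<bar>x\<bar> - 1 - 2j)\<close>.  Hence the joint eigenvectors belong to distinct
  eigenvalues of a single operator \<open>Q\<close>, and by their number they form a basis.\<close>

lemma shifted_dirac_spectrum:
  assumes s: "CARD('s) = 2"
  defines "D' \<equiv> \<lambda>X. \<DD> X + 2 *s X"
  shows "op_spectrum D' = of_int ` eigenvalues n"
    and "x \<in> eigenvalues n \<Longrightarrow> eigen_mult D' (of_int x) = nat \<bar>x\<bar>"
proof -
  interpret D: Vector_Spaces.linear "(*s)" "(*s)" \<DD> by (rule dirac_linear)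
  interpret W: Vector_Spaces.linear "(*s)" "(*s)" \<W> by (rule linear_weight_op)
  have D': "Vector_Spaces.linear (*s) (*s) D'"
    by unfold_locales (simp_all add: D'_def D.add D.scale vec.scale_right_distrib vec.scale_left_distrib mult.commute)
  define Q where "Q X = D' X + \<i> *s \<W> X" for X
  have Q: "Vector_Spaces.linear (*s) (*s) Q"
    by unfold_locales (simp_all add: Q_def D'_def D.add D.scale W.add W.scale
        vec.scale_right_distrib vec.scale_left_distrib mult.commute)
  define I where "I = (SIGMA x:eigenvalues n. {..<nat \<bar>x\<bar>})"
  have fin: "finite (eigenvalues n)" by (simp add: eigenvalues_def)
  have I: "finite I" "card I = CARD(('d \<times> 'd) \<times> 's)"
    using fin dimension s by (simp_all add: I_def sum_eigenvalues power2_eq_square)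
  define \<mu> where "\<mu> = (\<lambda>(x, j). of_int x + \<i> * of_int (\<bar>x\<bar> - 1 - 2 * int j))"
  have "inj_on \<mu> I"
    by (auto simp: inj_on_def \<mu>_def complex_eq_iff)
  moreover have "Q (joint_eigenvector i) = \<mu> i *s joint_eigenvector i \<and> joint_eigenvector i \<noteq> 0" if "i \<in> I" for i
  proof -
    obtain x j where i: "i = (x, j)" "x \<in> eigenvalues n" "j < nat \<bar>x\<bar>"
      using \<open>i \<in> I\<close> by (auto simp: I_def)
    show ?thesis
      unfolding i(1) Q_def D'_def \<mu>_def prod.case joint_eigenvector(1,2)[OF i(2,3)] vec.scale_scale
      using joint_eigenvector(3)[OF i(2,3)] by (simp only: vec.scale_left_distrib simp_thms)
  qed
  ultimately have ind: "independent_family I joint_eigenvector"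
    unfolding independent_family_def using vec.eigenvectors_independent[OF Q I(1), of \<mu> joint_eigenvector] by blast
  have ev: "D' (joint_eigenvector i) = of_int (fst i) *s joint_eigenvector i" if "i \<in> I" for i
    using that joint_eigenvector by (auto simp: I_def D'_def)
  note eb = eigenbasis[OF D' I ind ev]
  have "(\<lambda>i. complex_of_int (fst i)) ` I = of_int ` eigenvalues n"
  proof -
    have "(x, 0) \<in> I" if "x \<in> eigenvalues n" for x
    proof -
      from that have "x \<noteq> 0" by (cases rule: eigenvalues_cases) auto
      with that show ?thesis by (simp add: I_def)
    qed
    then have "eigenvalues n \<subseteq> fst ` I" by force
    moreover have "fst ` I \<subseteq> eigenvalues n" by (auto simp: I_def)
    ultimately have "fst ` I = eigenvalues n" by blast
    then show ?thesis by (metis image_image)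
  qed
  then show "op_spectrum D' = of_int ` eigenvalues n" using eb(1) by simp
  show "eigen_mult D' (of_int x) = nat \<bar>x\<bar>" if "x \<in> eigenvalues n" for x
  proof -
    have "{i \<in> I. complex_of_int (fst i) = of_int x} = {x} \<times> {..<nat \<bar>x\<bar>}"
      using that by (auto simp: I_def)
    then show ?thesis using eb(2)[of "of_int x"] by simp
  qed
qed

end

lemma op_spectrum_shift: "op_spectrum (\<lambda>v. f v + c *s v) = (\<lambda>z. z + c) ` op_spectrum f"
proof -
  have "(\<lambda>v. f v + c *s v - z *s v) = (\<lambda>v. f v - (z - c) *s v)" for z
    by (simp add: fun_eq_iff vec_eq_iff algebra_simps)
  then have "z \<in> op_spectrum (\<lambda>v. f v + c *s v) \<longleftrightarrow> z - c \<in> op_spectrum f" for z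
    by (simp add: op_spectrum_def)
  then show ?thesis by (force simp: image_iff)
qed

theorem theorem9p4:
  fixes n :: nat
    and U :: "complex^2^2 \<Rightarrow> complex^'d^'d"
    and \<kappa> :: "clifford \<Rightarrow> complex^2^2"
    and D D' :: "complex^(('d \<times> 'd) \<times> 2) \<Rightarrow> complex^(('d \<times> 'd) \<times> 2)"
  assumes U: "SU2_irrep U n"
    and \<kappa>: "clifford_irrep \<kappa>"
    and gamma: "\<kappa> cl_gamma = mat 1"
    and D: "D = dirac U \<kappa>"
    and D': "D' = (\<lambda>X. D X + 2 *s X)"
  shows "op_spectrum D' = (\<Union>k\<in>{1..n}. {2 * of_nat k, - 2 * of_nat k}) \<union> {2 * of_nat (n + 1)}
    \<and> (\<forall>k\<in>{1..n}. eigen_mult D' (2 * of_nat k) = 2 * k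
                  \<and> eigen_mult D' (- 2 * of_nat k) = 2 * k
                  \<and> (\<forall>V :: complex^2^2 \<Rightarrow> complex^'e^'e. SU2_irrep V (2 * k - 1)
                        \<longrightarrow> vec.dim (UNIV :: (complex^'e) set) = 2 * k))
    \<and> eigen_mult D' (2 * of_nat (n + 1)) = 2 * (n + 1)
    \<and> (\<forall>V :: complex^2^2 \<Rightarrow> complex^'e^'e. SU2_irrep V (2 * n + 1)
          \<longrightarrow> vec.dim (UNIV :: (complex^'e) set) = 2 * (n + 1))
    \<and> op_spectrum D = (\<lambda>z. z - 2) ` op_spectrum D'"
proof -
  interpret su2_irrep U n using U by (simp add: SU2_irrep_iff)
  have "clifford_rep \<kappa>" using \<kappa> by (simp add: clifford_irrep_def)
  from spinor_pair_exists[OF this gamma] obtain u d where "spinor_pair \<kappa> u d" by blast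
  then interpret su2_dirac U n \<kappa> u d by unfold_locales
  have D'': "D' = (\<lambda>X. dirac U \<kappa> X + 2 *s X)" by (simp add: D D')
  have "CARD(2) = 2" by simp
  note spec = shifted_dirac_spectrum[OF this, folded D'']
  have set: "of_int ` eigenvalues n = (\<Union>k\<in>{1..n}. {2 * of_nat k, - 2 * of_nat k}) \<union> {2 * complex_of_nat (n + 1)}"
  proof -
    have "{1..n + 1} = insert (n + 1) {1..n}" by auto
    then show ?thesis by (auto simp: eigenvalues_def image_Un image_image)
  qed
  have pos: "eigen_mult D' (2 * of_nat k) = 2 * k" if "k \<in> {1..n + 1}" for k
  proof -
    have "2 * int k \<in> eigenvalues n" using that by (auto simp: eigenvalues_def)
    from spec(2)[OF this] show ?thesis by (simp add: nat_mult_distrib)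
  qed
  have neg: "eigen_mult D' (- 2 * of_nat k) = 2 * k" if "k \<in> {1..n}" for k
  proof -
    have "- 2 * int k \<in> eigenvalues n" using that by (auto simp: eigenvalues_def)
    from spec(2)[OF this] show ?thesis by (simp add: nat_mult_distrib)
  qed
  have dim: "vec.dim (UNIV :: (complex^'e) set) = m + 1"
    if "SU2_irrep V m" for V :: "complex^2^2 \<Rightarrow> complex^'e^'e" and m
    using su2_irrep.dimension[of V m] that by (simp add: SU2_irrep_iff card_cart_basis)
  show ?thesis
  proof (intro conjI ballI allI impI)
    show "op_spectrum D' = (\<Union>k\<in>{1..n}. {2 * of_nat k, - 2 * of_nat k}) \<union> {2 * of_nat (n + 1)}"
      unfolding spec(1) by (rule set)
    show "eigen_mult D' (2 * of_nat (n + 1)) = 2 * (n + 1)" by (rule pos) simp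
    show "op_spectrum D = (\<lambda>z. z - 2) ` op_spectrum D'"
      unfolding D' op_spectrum_shift by (simp add: image_image)
  next
    fix k assume k: "k \<in> {1..n}"
    show "eigen_mult D' (2 * of_nat k) = 2 * k" using k by (intro pos) simp
    show "eigen_mult D' (- 2 * of_nat k) = 2 * k" using k by (rule neg)
    fix V :: "complex^2^2 \<Rightarrow> complex^'e^'e" assume "SU2_irrep V (2 * k - 1)"
    from dim[OF this] show "vec.dim (UNIV :: (complex^'e) set) = 2 * k" using k by simp
  next
    fix V :: "complex^2^2 \<Rightarrow> complex^'e^'e" assume "SU2_irrep V (2 * n + 1)"
    from dim[OF this] show "vec.dim (UNIV :: (complex^'e) set) = 2 * (n + 1)" by simp
  qed
qed

end
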